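(* Let $k$ be an infinite field, $n\ge1$, $0\le d\le n$, and let $<$ be a term order on $k[X_1,\ldots,X_n]$ with $X_1<\cdots<X_n$. Let $A\subseteq k^n$ be a finite union of pairwise distinct affine $d$-planes (its irreducible components). For each $J\subseteq\{1,\ldots,n\}$ with $\#J=d$, let $m_J$ be the number of irreducible components of $A$ whose minimal free variables are $\{X_j;\ j\in J\}$. Then for every such $J$, the number of $d$-planes in $D(A)$ parallel to $\bigoplus_{j\in J}\mathbb{N}e_j$ equals $m_J$. (In particular the total number of $d$-planes in $D(A)$ equals the number of irreducible components of $A$.)
   Context: $k[X]=k[X_1,\ldots,X_n]$; $e_i$ denotes the $i$-th standard basis vector of $\mathbb{N}^n$. For $A\subseteq k^n$, $I(A)$ is the ideal of all polynomials vanishing on $A$. For nonzero $f\in k[X]$, ${\rm LE}(f)\in\mathbb{N}^n$ is the exponent of the leading monomial of $f$ with respect to $<$. $C(A)=\{{\rm LE}(f);\ 0\ne f\in I(A)\}$ and the standard set is $D(A)=\mathbb{N}^n\setminus C(A)$. For a subset $\delta\subseteq\mathbb{N}^n$, a $d$-plane in $\delta$ is a subset of $\delta$ of the form $\gamma+\bigoplus_{j\in J}\mathbb{N}e_j$ where $J\subseteq\{1,\ldots,n\}$, $\#J=d$, $\gamma\in\mathbb{N}^n$ and $\gamma_j=0$ for all $j\in J$; it is said to be parallel to $\bigoplus_{j\in J}\mathbb{N}e_j$. An affine $d$-plane of $k^n$ is a translate of a $d$-dimensional linear subspace. For $\#J=d$, $\{X_j;\ j\in J\}$ is a set of free variables of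 an affine $d$-plane $A'$ if the coordinate projection $A'\to k^J$ is a bijection; they are the minimal free variables of $A'$ if, in addition, for every $j\in J$ there is no $i\notin J$ with $i<j$ such that $\{X_j;\ j\in (J\setminus\{j\})\cup\{i\}\}$ is a set of free variables of $A'$. *)

theory Defs
  imports Complex_Main "HOL-Library.Poly_Mapping" "HOL-Library.Function_Algebras" "HOL-Library.FuncSet"
begin

text \<open>Variables X_1,...,X_n are indexed by 0,...,n-1. Exponent vectors in N^n are
finitely supported maps nat \<Rightarrow>0 nat with support in {..<n}; polynomials are
finitely supported maps from exponent vectors to coefficients.\<close>

definition mons :: "nat \<Rightarrow> (nat \<Rightarrow>\<^sub>0 nat) set" where
  "mons n = {\<alpha>. Poly_Mapping.keys \<alpha> \<subseteq> {..<n}}"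

definition kn :: "nat \<Rightarrow> (nat \<Rightarrow> 'a::zero) set" where
  "kn n = {x. \<forall>i\<ge>n. x i = 0}"

definition poly_in :: "nat \<Rightarrow> ((nat \<Rightarrow>\<^sub>0 nat) \<Rightarrow>\<^sub>0 'a::zero) \<Rightarrow> bool" where
  "poly_in n f \<longleftrightarrow> Poly_Mapping.keys f \<subseteq> mons n"

definition peval :: "((nat \<Rightarrow>\<^sub>0 nat) \<Rightarrow>\<^sub>0 'a::comm_semiring_1) \<Rightarrow> (nat \<Rightarrow> 'a) \<Rightarrow> 'a" where
  "peval f x = (\<Sum>\<alpha>\<in>Poly_Mapping.keys f. Poly_Mapping.lookup f \<alpha> * (\<Prod>i\<in>Poly_Mapping.keys \<alpha>. x i ^ Poly_Mapping.lookup \<alpha> i))"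

definition term_order :: "nat \<Rightarrow> ((nat \<Rightarrow>\<^sub>0 nat) \<Rightarrow> (nat \<Rightarrow>\<^sub>0 nat) \<Rightarrow> bool) \<Rightarrow> bool" where
  "term_order n lt \<longleftrightarrow>
     (\<forall>\<alpha>\<in>mons n. \<not> lt \<alpha> \<alpha>) \<and>
     (\<forall>\<alpha>\<in>mons n. \<forall>\<beta>\<in>mons n. \<forall>\<gamma>\<in>mons n. lt \<alpha> \<beta> \<longrightarrow> lt \<beta> \<gamma> \<longrightarrow> lt \<alpha> \<gamma>) \<and>
     (\<forall>\<alpha>\<in>mons n. \<forall>\<beta>\<in>mons n. \<alpha> = \<beta> \<or> lt \<alpha> \<beta> \<or> lt \<beta> \<alpha>) \<and>
     (\<forall>\<alpha>\<in>mons n. \<alpha> \<noteq> 0 \<longrightarrow> lt 0 \<alpha>) \<and>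
     (\<forall>\<alpha>\<in>mons n. \<forall>\<beta>\<in>mons n. \<forall>\<gamma>\<in>mons n. lt \<alpha> \<beta> \<longrightarrow> lt (\<alpha> + \<gamma>) (\<beta> + \<gamma>))"

definition vars_increasing :: "nat \<Rightarrow> ((nat \<Rightarrow>\<^sub>0 nat) \<Rightarrow> (nat \<Rightarrow>\<^sub>0 nat) \<Rightarrow> bool) \<Rightarrow> bool" where
  "vars_increasing n lt \<longleftrightarrow>
     (\<forall>i j. i < j \<and> j < n \<longrightarrow> lt (Poly_Mapping.single i 1) (Poly_Mapping.single j 1))"

definition lead_exp ::
  "((nat \<Rightarrow>\<^sub>0 nat) \<Rightarrow> (nat \<Rightarrow>\<^sub>0 nat) \<Rightarrow> bool) \<Rightarrow> ((nat \<Rightarrow>\<^sub>0 nat) \<Rightarrow>\<^sub>0 'a::zero) \<Rightarrow> (nat \<Rightarrow>\<^sub>0 nat)" where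
  "lead_exp lt f = (THE \<alpha>. \<alpha> \<in> Poly_Mapping.keys f \<and> (\<forall>\<beta>\<in>Poly_Mapping.keys f. \<beta> \<noteq> \<alpha> \<longrightarrow> lt \<beta> \<alpha>))"

definition vanishing_ideal :: "nat \<Rightarrow> (nat \<Rightarrow> 'a::comm_semiring_1) set \<Rightarrow> ((nat \<Rightarrow>\<^sub>0 nat) \<Rightarrow>\<^sub>0 'a) set" where
  "vanishing_ideal n A = {f. poly_in n f \<and> (\<forall>x\<in>A. peval f x = 0)}"

definition C_set :: "nat \<Rightarrow> ((nat \<Rightarrow>\<^sub>0 nat) \<Rightarrow> (nat \<Rightarrow>\<^sub>0 nat) \<Rightarrow> bool) \<Rightarrow> (nat \<Rightarrow> 'a::comm_semiring_1) set \<Rightarrow> (nat \<Rightarrow>\<^sub>0 nat) set" where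
  "C_set n lt A = {lead_exp lt f | f. f \<in> vanishing_ideal n A \<and> f \<noteq> 0}"

definition D_set :: "nat \<Rightarrow> ((nat \<Rightarrow>\<^sub>0 nat) \<Rightarrow> (nat \<Rightarrow>\<^sub>0 nat) \<Rightarrow> bool) \<Rightarrow> (nat \<Rightarrow> 'a::comm_semiring_1) set \<Rightarrow> (nat \<Rightarrow>\<^sub>0 nat) set" where
  "D_set n lt A = mons n - C_set n lt A"

definition planes_in :: "nat \<Rightarrow> (nat \<Rightarrow>\<^sub>0 nat) set \<Rightarrow> nat set \<Rightarrow> (nat \<Rightarrow>\<^sub>0 nat) set set" where
  "planes_in n \<delta> J = {P. \<exists>\<gamma>\<in>mons n. (\<forall>j\<in>J. Poly_Mapping.lookup \<gamma> j = 0) \<and>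
       P = {\<gamma> + \<beta> | \<beta>. Poly_Mapping.keys \<beta> \<subseteq> J} \<and> P \<subseteq> \<delta>}"

definition kscale :: "'a::times \<Rightarrow> (nat \<Rightarrow> 'a) \<Rightarrow> (nat \<Rightarrow> 'a)" where
  "kscale c v = (\<lambda>i. c * v i)"

definition affine_plane :: "nat \<Rightarrow> nat \<Rightarrow> (nat \<Rightarrow> 'a::field) set \<Rightarrow> bool" where
  "affine_plane n d P \<longleftrightarrow> (\<exists>p V. p \<in> kn n \<and> V \<subseteq> kn n \<and> module.subspace kscale V \<and>
      vector_space.dim kscale V = d \<and> P = (\<lambda>v. p + v) ` V)"

definition free_vars :: "nat \<Rightarrow> nat \<Rightarrow> (nat \<Rightarrow> 'a) set \<Rightarrow> nat set \<Rightarrow> bool" where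
  "free_vars n d P J \<longleftrightarrow> J \<subseteq> {..<n} \<and> card J = d \<and>
      bij_betw (\<lambda>x. restrict x J) P (PiE J (\<lambda>_. UNIV))"

definition minimal_free_vars :: "nat \<Rightarrow> nat \<Rightarrow> (nat \<Rightarrow> 'a) set \<Rightarrow> nat set \<Rightarrow> bool" where
  "minimal_free_vars n d P J \<longleftrightarrow> free_vars n d P J \<and>
      (\<forall>j\<in>J. \<not> (\<exists>i<n. i \<notin> J \<and> i < j \<and> free_vars n d P ((J - {j}) \<union> {i})))"

end

theory Submission
  imports Defs "HOL-Computational_Algebra.Polynomial"
begin

text \<open>The upper bound on the total number of d-planes in \<open>D(A)\<close> is a count by total degree: monomials
  in \<open>D(A)\<close> are linearly independent as functions on \<open>A\<close>, while the functions of degree at most \<open>t\<close> on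
  each of the components form a space of dimension at most \<open>binomial (d + t) d\<close>.

  For the lower bound fix \<open>J\<close> and consider the components \<open>P\<close> whose minimal free variables are \<open>J\<close>.
  On each of them \<open>X_i\<close> restricts to an affine form in the \<open>X_j\<close> with \<open>j\<close> in \<open>J\<close> and \<open>j \<le> i\<close>. If there were
  fewer apices \<open>\<gamma>\<close> of J-planes in \<open>D(A)\<close> than such components, some nonzero \<open>k[X_J]\<close>-linear combination
  \<open>\<Lambda>\<close> of the restriction maps to these components would kill all \<open>X^\<gamma>\<close>. Choose \<open>\<gamma>\<close> free of the variables in \<open>J\<close> such that
  the difference \<open>LE (\<Lambda> X^\<gamma>) - \<gamma>\<close> is maximal; it exists since each \<open>X_i\<close> is integral over \<open>k[X_J]\<close>. As
  \<open>\<gamma>\<close> is not an apex, some \<open>f\<close> in \<open>I(A)\<close> has leading exponent \<open>\<gamma> + \<beta>\<close> with \<open>\<beta>\<close> supported on \<open>J\<close>, and by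
  maximality the leading term of \<open>\<Lambda> (X^(\<gamma> + \<beta>))\<close> cannot cancel in \<open>\<Lambda> f = 0\<close>.

  Both bounds agree because every component has minimal free variables.\<close>

type_synonym expo = "nat \<Rightarrow>\<^sub>0 nat"
type_synonym 'a mpoly = "expo \<Rightarrow>\<^sub>0 'a"

abbreviation "keys \<equiv> Poly_Mapping.keys"
abbreviation "lookup \<equiv> Poly_Mapping.lookup"
abbreviation "single \<equiv> Poly_Mapping.single"

section \<open>Evaluation and substitution\<close>

lemma sum_singles: "(\<Sum>\<alpha>\<in>keys f. single \<alpha> (lookup f \<alpha>)) = f"
  by (rule poly_mapping_eqI) (auto simp: lookup_sum lookup_single when_def in_keys_iff)

lemma lookup_single_mult:
  fixes p :: "'a::comm_semiring_1 mpoly"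
  shows "lookup (single \<beta> c * p) (\<beta> + \<delta>) = c * lookup p \<delta>"
proof -
  have "single \<beta> c * p = (\<Sum>\<alpha>\<in>keys p. single (\<beta> + \<alpha>) (c * lookup p \<alpha>))"
    by (subst (1) sum_singles[symmetric]) (simp add: sum_distrib_left mult_single)
  then show ?thesis
    by (auto simp: lookup_sum lookup_single when_def in_keys_iff)
qed

lemma keys_single_mult:
  "keys (single \<beta> c * p) \<subseteq> (\<lambda>\<delta>. \<beta> + \<delta>) ` keys (p :: 'a::comm_semiring_1 mpoly)"
  using keys_mult[of "single \<beta> c" p] by (auto split: if_splits)

text \<open>The target ring is left open so that the same monomial can be evaluated at points of
  \<open>k^n\<close> and at tuples of polynomials.\<close>

definition meval :: "(nat \<Rightarrow> 'b::comm_semiring_1) \<Rightarrow> expo \<Rightarrow> 'b" where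
  "meval x \<alpha> = (\<Prod>i\<in>keys \<alpha>. x i ^ lookup \<alpha> i)"

lemma meval_superset:
  assumes "finite K" "keys \<alpha> \<subseteq> K"
  shows "meval x \<alpha> = (\<Prod>i\<in>K. x i ^ lookup \<alpha> i)"
  unfolding meval_def using assms
  by (intro prod.mono_neutral_left) (auto simp: in_keys_iff)

lemma meval_0 [simp]: "meval x 0 = 1"
  by (simp add: meval_def)

lemma meval_add: "meval x (\<alpha> + \<beta>) = meval x \<alpha> * meval x \<beta>"
proof -
  have "keys (\<alpha> + \<beta>) \<subseteq> keys \<alpha> \<union> keys \<beta>" by (rule keys_add)
  then show ?thesis
    by (simp add: meval_superset[where K = "keys \<alpha> \<union> keys \<beta>"] lookup_add power_add prod.distrib)
qed

lemma meval_single: "meval x (single i m) = x i ^ m"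
  by (simp add: meval_def)

lemma meval_mult: "meval (\<lambda>i. x i * y i) \<alpha> = meval x \<alpha> * meval y \<alpha>"
  by (simp add: meval_def power_mult_distrib prod.distrib)

text \<open>Covers evaluation and substitution at once: \<open>h\<close> is the identity for values
  at a point, and the embedding of constants when polynomials are substituted for the
  variables.\<close>

locale coeff_hom =
  fixes h :: "'a::comm_semiring_1 \<Rightarrow> 'b::comm_semiring_1"
  assumes h_0: "h 0 = 0" and h_1: "h 1 = 1"
    and h_add: "h (a + b) = h a + h b" and h_mult: "h (a * b) = h a * h b"
begin

definition geval :: "(nat \<Rightarrow> 'b) \<Rightarrow> 'a mpoly \<Rightarrow> 'b" where
  "geval x f = (\<Sum>\<alpha>\<in>keys f. h (lookup f \<alpha>) * meval x \<alpha>)"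

lemma geval_superset:
  assumes "finite K" "keys f \<subseteq> K"
  shows "geval x f = (\<Sum>\<alpha>\<in>K. h (lookup f \<alpha>) * meval x \<alpha>)"
  unfolding geval_def using assms
  by (intro sum.mono_neutral_left) (auto simp: in_keys_iff h_0)

lemma geval_0 [simp]: "geval x 0 = 0"
  by (simp add: geval_def)

lemma geval_add: "geval x (f + g) = geval x f + geval x g"
proof -
  have "keys (f + g) \<subseteq> keys f \<union> keys g" by (rule keys_add)
  then show ?thesis
    by (simp add: geval_superset[where K = "keys f \<union> keys g"] lookup_add h_add
        distrib_right sum.distrib)
qed

lemma geval_sum: "geval x (\<Sum>i\<in>I. f i) = (\<Sum>i\<in>I. geval x (f i))"
  by (induction I rule: infinite_finite_induct) (auto simp: geval_add)

lemma geval_single: "geval x (single \<alpha> c) = h c * meval x \<alpha>"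
  by (simp add: geval_def h_0)

lemma geval_1 [simp]: "geval x 1 = 1"
  using geval_single[of x 0 1] by (simp add: h_1)

lemma geval_mult: "geval x (f * g) = geval x f * geval x g"
proof -
  have "f * g = (\<Sum>\<alpha>\<in>keys f. \<Sum>\<beta>\<in>keys g. single (\<alpha> + \<beta>) (lookup f \<alpha> * lookup g \<beta>))"
    by (subst (1 2) sum_singles[symmetric]) (simp add: sum_product mult_single)
  then have "geval x (f * g)
      = (\<Sum>\<alpha>\<in>keys f. \<Sum>\<beta>\<in>keys g. (h (lookup f \<alpha>) * meval x \<alpha>) * (h (lookup g \<beta>) * meval x \<beta>))"
    by (simp add: geval_sum geval_single h_mult meval_add mult_ac)
  then show ?thesis
    by (simp add: geval_def sum_product)
qed

lemma geval_prod: "geval x (\<Prod>i\<in>I. f i) = (\<Prod>i\<in>I. geval x (f i))"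
  by (induction I rule: infinite_finite_induct) (auto simp: geval_mult)

lemma geval_power: "geval x (f ^ m) = geval x f ^ m"
  by (induction m) (auto simp: geval_mult)

lemma geval_meval: "geval x (meval g \<alpha>) = meval (\<lambda>i. geval x (g i)) \<alpha>"
  by (simp add: meval_def geval_prod geval_power)

end

interpretation ev: coeff_hom "\<lambda>c::'a::comm_semiring_1. c"
  by unfold_locales auto

interpretation sb: coeff_hom "\<lambda>c::'a::comm_semiring_1. single (0::expo) c"
  by unfold_locales (auto simp: single_add mult_single)

lemma peval_eq_geval: "peval f x = ev.geval x f"
  by (simp add: peval_def ev.geval_def meval_def)

abbreviation psub :: "(nat \<Rightarrow> 'a::comm_semiring_1 mpoly) \<Rightarrow> 'a mpoly \<Rightarrow> 'a mpoly" where
  "psub \<equiv> sb.geval"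

lemma psub_uminus: "psub g (- f) = - psub g (f :: 'a::comm_ring_1 mpoly)"
  using sb.geval_add[of g f "- f"] by (simp add: eq_neg_iff_add_eq_0 add.commute)

lemma psub_diff: "psub g (f - f') = psub g f - psub g (f' :: 'a::comm_ring_1 mpoly)"
  using sb.geval_add[of g f "- f'"] by (simp add: psub_uminus)

lemma peval_psub: "peval (psub g f) x = peval f (\<lambda>i. peval (g i) x)"
  unfolding peval_eq_geval
  by (simp add: sb.geval_def ev.geval_sum ev.geval_mult ev.geval_single ev.geval_meval)
     (simp add: ev.geval_def)

text \<open>Monomials are characters of the multiplicative monoid of points, so this is Artin's
  argument for the linear independence of characters.\<close>

lemma monomials_independent:
  fixes c :: "expo \<Rightarrow> 'a::field"
  assumes inf: "infinite (UNIV :: 'a set)"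
    and "finite K" "\<And>x. (\<Sum>\<alpha>\<in>K. c \<alpha> * meval x \<alpha>) = 0"
  shows "\<forall>\<alpha>\<in>K. c \<alpha> = 0"
  using assms(2,3)
proof (induction K arbitrary: c rule: finite_induct)
  case (insert \<alpha>0 K)
  \<comment> \<open>Two distinct monomials differ at a point whose coordinates are all 1 except one,
    \<open>t\<close>. It suffices that \<open>t\<close> avoids 0 and the finitely many roots of
    \<open>t ^ (b - a) = 1\<close>, which an infinite field permits.\<close>
  have separate: "\<exists>y. meval y \<alpha> \<noteq> (meval y \<alpha>0 :: 'a)" if "\<alpha> \<in> K" for \<alpha>
  proof -
    have "\<alpha> \<noteq> \<alpha>0" using that insert by auto
    then obtain i where i: "lookup \<alpha> i \<noteq> lookup \<alpha>0 i" by (meson poly_mapping_eqI)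
    define a b where "a = min (lookup \<alpha> i) (lookup \<alpha>0 i)" and "b = max (lookup \<alpha> i) (lookup \<alpha>0 i)"
    have ab: "a < b" using i by (auto simp: a_def b_def)
    have "finite {t::'a. t = 0 \<or> t ^ (b - a) = 1}"
    proof -
      have "monom 1 (b - a) - 1 \<noteq> (0 :: 'a poly)"
        using ab by (metis degree_1 degree_monom_eq eq_iff_diff_eq_0 nat_less_le zero_less_diff one_neq_zero)
      then have "finite {t::'a. t ^ (b - a) = 1}"
        using poly_roots_finite[of "monom 1 (b - a) - 1 :: 'a poly"] by (simp add: poly_monom)
      then show ?thesis by simp
    qed
    then have "\<exists>t::'a. \<not> (t = 0 \<or> t ^ (b - a) = 1)"
      using ex_new_if_finite[OF inf, of "{t::'a. t = 0 \<or> t ^ (b - a) = 1}"] by auto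
    then obtain t :: 'a where t: "t \<noteq> 0" "t ^ (b - a) \<noteq> 1" by auto
    have "t ^ b = t ^ a * t ^ (b - a)" using ab by (simp flip: power_add)
    then have "t ^ b \<noteq> t ^ a" using t by auto
    then have ne: "t ^ lookup \<alpha> i \<noteq> t ^ lookup \<alpha>0 i"
      by (auto simp: a_def b_def min_def max_def split: if_splits)
    have "meval (\<lambda>j. if j = i then t else 1) \<gamma> = t ^ lookup \<gamma> i" for \<gamma>
    proof -
      have "meval (\<lambda>j. if j = i then t else 1) \<gamma>
          = (\<Prod>j\<in>insert i (keys \<gamma>). (if j = i then t else 1) ^ lookup \<gamma> j)"
        by (rule meval_superset) auto
      also have "\<dots> = (\<Prod>j\<in>insert i (keys \<gamma>). if j = i then t ^ lookup \<gamma> i else 1)"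
        by (rule prod.cong) auto
      finally show ?thesis by simp
    qed
    then show ?thesis using ne by metis
  qed
  \<comment> \<open>The relation at the product point \<open>y i * x i\<close>, minus
    \<open>meval y \<alpha>0\<close> times the relation at \<open>x\<close>, no longer contains
    \<alpha>0, so the induction hypothesis applies to it.\<close>
  have "\<forall>\<alpha>\<in>K. c \<alpha> * (meval y \<alpha> - meval y \<alpha>0) = 0" for y
  proof (rule insert.IH)
    fix x
    have "(\<Sum>\<alpha>\<in>insert \<alpha>0 K. c \<alpha> * meval (\<lambda>i. y i * x i) \<alpha>)
        - meval y \<alpha>0 * (\<Sum>\<alpha>\<in>insert \<alpha>0 K. c \<alpha> * meval x \<alpha>) = 0"
      using insert.prems by simp
    moreover have "(\<Sum>\<alpha>\<in>K. c \<alpha> * (meval y \<alpha> - meval y \<alpha>0) * meval x \<alpha>)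
        = (\<Sum>\<alpha>\<in>K. c \<alpha> * (meval y \<alpha> * meval x \<alpha>)) - meval y \<alpha>0 * (\<Sum>\<alpha>\<in>K. c \<alpha> * meval x \<alpha>)"
      by (simp add: sum_distrib_left algebra_simps sum_subtractf)
    ultimately show "(\<Sum>\<alpha>\<in>K. c \<alpha> * (meval y \<alpha> - meval y \<alpha>0) * meval x \<alpha>) = 0"
      using insert.hyps by (simp add: meval_mult distrib_left mult_ac)
  qed
  then have K0: "\<forall>\<alpha>\<in>K. c \<alpha> = 0" using separate by force
  moreover have "(\<Sum>\<alpha>\<in>insert \<alpha>0 K. c \<alpha> * meval (\<lambda>_. 1) \<alpha>) = 0" by (rule insert.prems)
  ultimately show ?case using insert.hyps by (simp add: meval_def)
qed simp

lemma peval_eq_0_imp_0: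
  fixes f :: "'a::field mpoly"
  assumes "infinite (UNIV :: 'a set)" "\<And>x. peval f x = 0"
  shows "f = 0"
proof -
  have "\<forall>\<alpha>\<in>keys f. lookup f \<alpha> = 0"
    using assms(2) by (intro monomials_independent[OF assms(1)]) (auto simp: peval_def meval_def)
  then show ?thesis by (auto simp: poly_mapping_eq_iff in_keys_iff fun_eq_iff)
qed

section \<open>Homogeneous linear systems over integral domains\<close>

text \<open>Gaussian elimination without division, so that a solution stays in the subring
  \<open>R\<close> containing the coefficients. The subring is what keeps later solutions inside the
  polynomials in the first \<open>n\<close> variables.\<close>

lemma underdetermined_system:
  fixes M :: "'e \<Rightarrow> 's \<Rightarrow> 'r::idom"
  assumes "finite E" "finite S" "card E < card S"
    and R: "1 \<in> R" "\<And>x y. x \<in> R \<Longrightarrow> y \<in> R \<Longrightarrow> x - y \<in> R" "\<And>x y. x \<in> R \<Longrightarrow> y \<in> R \<Longrightarrow> x * y \<in> R"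
    and "\<And>e s. e \<in> E \<Longrightarrow> s \<in> S \<Longrightarrow> M e s \<in> R"
  shows "\<exists>l. (\<forall>s\<in>S. l s \<in> R) \<and> (\<exists>s\<in>S. l s \<noteq> 0) \<and> (\<forall>e\<in>E. (\<Sum>s\<in>S. M e s * l s) = 0)"
  using assms(1,2,3,7)
proof (induction E arbitrary: S M rule: finite_induct)
  case empty
  then show ?case using R(1) by (intro exI[of _ "\<lambda>_. 1"]) (auto simp: card_gt_0_iff)
next
  case (insert e E)
  have R0: "0 \<in> R" using R(2)[OF R(1) R(1)] by simp
  have R_uminus: "- x \<in> R" if "x \<in> R" for x using R(2)[OF R0 that] by simp
  have R_add: "x + y \<in> R" if "x \<in> R" "y \<in> R" for x y using R(2)[OF that(1) R_uminus[OF that(2)]] by simp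
  have R_sum: "(\<Sum>i\<in>I. f i) \<in> R" if "\<And>i. i \<in> I \<Longrightarrow> f i \<in> R" for I and f :: "'s \<Rightarrow> 'r"
    using that by (induction I rule: infinite_finite_induct) (auto simp: R0 R_add)
  show ?case
  proof (cases "\<forall>s\<in>S. M e s = 0")
    case True
    have "card E < card S" using insert by simp
    from insert.IH[OF insert.prems(1) this, of M] insert.prems(3) True show ?thesis by auto
  next
    case False
    then obtain p where p: "p \<in> S" "M e p \<noteq> 0" by auto
    \<comment> \<open>Cross-multiplying with the pivot \<open>M e p\<close> eliminates the unknown
      \<open>p\<close> from the other equations.\<close>
    define M' where "M' f s = M e p * M f s - M f p * M e s" for f s
    have M'_R: "M' f s \<in> R" if "f \<in> E" "s \<in> S - {p}" for f s
      unfolding M'_def using that p insert.prems(3) by (intro R) auto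
    have "card E < card (S - {p})" using insert p by (simp add: card_Diff_singleton)
    have "\<exists>l. (\<forall>s\<in>S - {p}. l s \<in> R) \<and> (\<exists>s\<in>S - {p}. l s \<noteq> 0) \<and>
        (\<forall>f\<in>E. (\<Sum>s\<in>S - {p}. M' f s * l s) = 0)"
      using insert.prems(1) \<open>card E < card (S - {p})\<close> M'_R by (intro insert.IH) auto
    then obtain l where
      l: "\<forall>s\<in>S - {p}. l s \<in> R" "\<exists>s\<in>S - {p}. l s \<noteq> 0" "\<forall>f\<in>E. (\<Sum>s\<in>S - {p}. M' f s * l s) = 0"
      by (elim exE conjE)
    \<comment> \<open>Equation \<open>e\<close> determines the unknown \<open>p\<close>; scaling all
      other unknowns by the pivot clears the denominator. They stay nonzero because the ring is a
      domain.\<close>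
    define l' where "l' s = (if s = p then - (\<Sum>s\<in>S - {p}. M e s * l s) else M e p * l s)" for s
    have split: "(\<Sum>s\<in>S. M f s * l' s) = (\<Sum>s\<in>S - {p}. M' f s * l s)" for f
    proof -
      have "(\<Sum>s\<in>S. M f s * l' s) = M f p * l' p + (\<Sum>s\<in>S - {p}. M f s * l' s)"
        using p insert.prems(1) by (simp add: sum.remove)
      also have "(\<Sum>s\<in>S - {p}. M f s * l' s) = (\<Sum>s\<in>S - {p}. M f s * (M e p * l s))"
        by (intro sum.cong) (auto simp: l'_def)
      also have "M f p * l' p + \<dots> = (\<Sum>s\<in>S - {p}. M' f s * l s)"
        by (simp add: l'_def M'_def sum_distrib_left algebra_simps sum_subtractf)
      finally show ?thesis .
    qed
    have "\<exists>s\<in>S. l' s \<noteq> 0" using l(2) p by (auto simp: l'_def)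
    moreover have "(\<Sum>s\<in>S. M f s * l' s) = 0" if "f \<in> insert e E" for f
      using that l(3) unfolding split by (cases "f = e") (auto simp: M'_def)
    moreover have "l' s \<in> R" if "s \<in> S" for s
      unfolding l'_def using that p insert.prems(3) l(1) by (auto intro!: R R_uminus R_sum)
    ultimately show ?thesis by blast
  qed
qed

section \<open>Affine planes and free variables\<close>

interpretation kv: vector_space "kscale :: 'a::field \<Rightarrow> (nat \<Rightarrow> 'a) \<Rightarrow> (nat \<Rightarrow> 'a)"
  by unfold_locales (auto simp: kscale_def algebra_simps fun_eq_iff)

lemma sum_fun_apply: "(\<Sum>i\<in>I. f i) x = (\<Sum>i\<in>I. f i x)"
  by (induction I rule: infinite_finite_induct) auto

text \<open>\<open>J\<close> is a smallest set of coordinates vanishing together only at 0 of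
  \<open>V\<close>. Dropping any \<open>j\<close> breaks this, which yields a vector of
  \<open>V\<close> that is zero on the rest of \<open>J\<close> but not at \<open>j\<close>;
  normalized, these vectors are the basis dual to the coordinates in \<open>J\<close>.\<close>

lemma subspace_dual_coordinates:
  fixes V :: "(nat \<Rightarrow> 'a::field) set"
  assumes "V \<subseteq> kn n" "kv.subspace V"
  obtains J w where "J \<subseteq> {..<n}" "card J = kv.dim V"
    "\<And>j. j \<in> J \<Longrightarrow> w j \<in> V" "\<And>i j. i \<in> J \<Longrightarrow> j \<in> J \<Longrightarrow> w j i = (if i = j then 1 else 0)"
    "\<And>v. v \<in> V \<Longrightarrow> v = (\<Sum>j\<in>J. kscale (v j) (w j))"
proof -
  define Q where "Q J \<longleftrightarrow> J \<subseteq> {..<n} \<and> (\<forall>v\<in>V. (\<forall>j\<in>J. v j = 0) \<longrightarrow> v = 0)" for J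
  have "Q {..<n}"
  proof -
    have "v i = 0" if "v \<in> V" "\<forall>j\<in>{..<n}. v j = 0" for v i
      using that assms(1) by (cases "i < n") (auto simp: kn_def)
    then show ?thesis by (auto simp: Q_def fun_eq_iff)
  qed
  then obtain J where J: "Q J" "\<And>K. Q K \<Longrightarrow> card J \<le> card K"
    using ex_has_least_nat[of Q _ card] by blast
  have finJ: "finite J" using J(1) by (auto simp: Q_def intro: finite_subset)
  have "\<exists>w\<in>V. \<forall>i\<in>J. w i = (if i = j then 1 else 0)" if "j \<in> J" for j
  proof -
    have "\<not> Q (J - {j})"
      using J(2)[of "J - {j}"] that finJ by (metis card_Diff1_less not_le)
    then obtain v where v: "v \<in> V" "\<forall>i\<in>J - {j}. v i = 0" "v \<noteq> 0"
      using J(1) by (auto simp: Q_def)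
    then have "v j \<noteq> 0" using J(1) by (auto simp: Q_def)
    then show ?thesis
      using v assms(2) that
      by (intro bexI[of _ "kscale (1 / v j) v"] kv.subspace_scale) (auto simp: kscale_def)
  qed
  then obtain w where w: "\<And>j. j \<in> J \<Longrightarrow> w j \<in> V"
    "\<And>i j. i \<in> J \<Longrightarrow> j \<in> J \<Longrightarrow> w j i = (if i = j then 1 else 0)"
    by metis
  have expand: "v = (\<Sum>j\<in>J. kscale (v j) (w j))" if "v \<in> V" for v
  proof -
    \<comment> \<open>The difference lies in \<open>V\<close> and vanishes on \<open>J\<close>, so
      it is 0 by the choice of \<open>J\<close>.\<close>
    define u where "u = v - (\<Sum>j\<in>J. kscale (v j) (w j))"
    have "u \<in> V" unfolding u_def
      using assms(2) that w(1) by (intro kv.subspace_diff kv.subspace_sum kv.subspace_scale) auto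
    moreover have "u i = 0" if "i \<in> J" for i
    proof -
      have "(\<Sum>j\<in>J. v j * w j i) = (\<Sum>j\<in>J. if j = i then v i else 0)"
        using w(2) that by (intro sum.cong) auto
      then show ?thesis using that finJ by (simp add: u_def sum_fun_apply kscale_def)
    qed
    ultimately have "u = 0" using J(1) by (auto simp: Q_def)
    then show ?thesis by (simp add: u_def)
  qed
  have inj: "inj_on w J"
    using w(2) by (intro inj_onI) (metis zero_neq_one)
  have "kv.independent (w ` J)"
  proof
    assume "kv.dependent (w ` J)"
    then obtain u j where u: "(\<Sum>v\<in>w ` J. kscale (u v) v) = 0" "j \<in> J" "u (w j) \<noteq> 0"
      using kv.dependent_finite[of "w ` J"] finJ by auto
    have "(\<Sum>i\<in>J. u (w i) * w i j) = (\<Sum>v\<in>w ` J. kscale (u v) v) j"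
      by (simp add: sum.reindex[OF inj] sum_fun_apply kscale_def)
    also have "\<dots> = 0" by (simp add: u)
    finally have "(\<Sum>i\<in>J. u (w i) * w i j) = 0" .
    moreover have "(\<Sum>i\<in>J. u (w i) * w i j) = (\<Sum>i\<in>J. if i = j then u (w j) else 0)"
      using w(2) u(2) by (intro sum.cong) auto
    ultimately show False using u finJ by simp
  qed
  moreover have "V \<subseteq> kv.span (w ` J)"
  proof
    fix v assume "v \<in> V"
    then have "v = (\<Sum>j\<in>J. kscale (v j) (w j))" by (rule expand)
    also have "\<dots> \<in> kv.span (w ` J)"
      by (intro kv.span_sum kv.span_scale kv.span_base) auto
    finally show "v \<in> kv.span (w ` J)" .
  qed
  ultimately have "kv.dim V = card J"
    using w(1) card_image[OF inj] by (intro kv.dim_unique[of "w ` J"]) auto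
  with that[of J w] J(1) w expand show thesis by (auto simp: Q_def)
qed

text \<open>The coordinates found for the direction space serve the plane too: the expansion in the
  dual basis gives injectivity, and combining that basis reaches every prescribed tuple of
  values.\<close>

lemma affine_plane_has_free_vars:
  fixes P :: "(nat \<Rightarrow> 'a::field) set"
  assumes "affine_plane n d P"
  obtains J where "free_vars n d P J"
proof -
  obtain p V where pV: "p \<in> kn n" "V \<subseteq> kn n" "kv.subspace V" "kv.dim V = d" "P = (\<lambda>v. p + v) ` V"
    using assms by (auto simp: affine_plane_def)
  obtain J w where J: "J \<subseteq> {..<n}" "card J = d"
    and w: "\<And>j. j \<in> J \<Longrightarrow> w j \<in> V" "\<And>i j. i \<in> J \<Longrightarrow> j \<in> J \<Longrightarrow> w j i = (if i = j then 1 else 0)"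
    and expand: "\<And>v. v \<in> V \<Longrightarrow> v = (\<Sum>j\<in>J. kscale (v j) (w j))"
    by (rule subspace_dual_coordinates[OF pV(2,3), unfolded pV(4)]) blast
  have finJ: "finite J" using J by (auto intro: finite_subset)
  have "inj_on (\<lambda>x. restrict x J) P"
  proof (rule inj_onI)
    fix x y assume xy: "x \<in> P" "y \<in> P" "restrict x J = restrict y J"
    then obtain v u where vu: "x = p + v" "y = p + u" "v \<in> V" "u \<in> V" using pV(5) by auto
    have "v j = u j" if "j \<in> J" for j
      using fun_cong[OF xy(3), of j] that vu by simp
    then have "(\<Sum>j\<in>J. kscale (v j) (w j)) = (\<Sum>j\<in>J. kscale (u j) (w j))" by simp
    then have "v = u" using expand vu(3,4) by metis
    then show "x = y" using vu by simp
  qed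
  moreover have "(\<lambda>x. restrict x J) ` P = PiE J (\<lambda>_. UNIV)"
  proof (intro equalityI subsetI)
    fix f :: "nat \<Rightarrow> 'a" assume f: "f \<in> PiE J (\<lambda>_. UNIV)"
    define v where "v = (\<Sum>j\<in>J. kscale (f j - p j) (w j))"
    have "v \<in> V" unfolding v_def
      using pV(3) w(1) by (intro kv.subspace_sum kv.subspace_scale) auto
    moreover have "v i = f i - p i" if "i \<in> J" for i
    proof -
      have "v i = (\<Sum>j\<in>J. if j = i then f i - p i else 0)"
        unfolding v_def sum_fun_apply kscale_def using w(2) that by (intro sum.cong) auto
      then show ?thesis using that finJ by simp
    qed
    then have "restrict (p + v) J = f"
      using f by (auto simp: fun_eq_iff restrict_def PiE_def extensional_def)
    ultimately show "f \<in> (\<lambda>x. restrict x J) ` P" using pV(5) by auto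
  qed auto
  ultimately show thesis using that[of J] J by (simp add: free_vars_def bij_betw_def)
qed

text \<open>Every exchange ruled out by minimality would lower the sum of the indices, so a set of
  free variables with least index sum is minimal.\<close>

lemma affine_plane_has_minimal_free_vars:
  fixes P :: "(nat \<Rightarrow> 'a::field) set"
  assumes "affine_plane n d P"
  obtains J where "minimal_free_vars n d P J"
proof -
  obtain J0 where "free_vars n d P J0" using affine_plane_has_free_vars[OF assms] .
  then obtain J where J: "free_vars n d P J" "\<And>K. free_vars n d P K \<Longrightarrow> \<Sum>J \<le> \<Sum>K"
    using ex_has_least_nat[of "free_vars n d P" J0 "\<lambda>J. \<Sum>J"] by blast
  have finJ: "finite J" using J(1) by (auto simp: free_vars_def intro: finite_subset)
  have False if "j \<in> J" "i \<notin> J" "i < j" "free_vars n d P (J - {j} \<union> {i})" for i j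
  proof -
    have "\<Sum>J = j + \<Sum>(J - {j})" using that finJ by (simp add: sum.remove)
    moreover have "\<Sum>(J - {j} \<union> {i}) = i + \<Sum>(J - {j})" using that finJ by simp
    ultimately show False using J(2)[OF that(4)] that by simp
  qed
  then show thesis using that[of J] J(1) by (auto simp: minimal_free_vars_def)
qed

lemma free_vars_point:
  assumes "free_vars n d P J"
  obtains x where "x \<in> P" "\<And>j. j \<in> J \<Longrightarrow> x j = \<xi> j"
proof -
  have "restrict \<xi> J \<in> (\<lambda>x. restrict x J) ` P"
    using assms by (auto simp: free_vars_def bij_betw_def)
  then obtain x where "x \<in> P" "restrict \<xi> J = restrict x J" by auto
  then show thesis using that[of x] by (metis restrict_apply')
qed

lemma free_vars_eqI:
  assumes "free_vars n d P J" "x \<in> P" "y \<in> P" "\<And>j. j \<in> J \<Longrightarrow> x j = y j"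
  shows "x = y"
proof -
  have "restrict x J = restrict y J" using assms(4) by auto
  with assms show ?thesis by (auto simp: free_vars_def bij_betw_def inj_on_def)
qed

text \<open>The inverse of the projection to the coordinates in \<open>J\<close> is affine. Its
  linear part is read off from directions \<open>w j\<close> of the plane lying over the unit
  vectors.\<close>

lemma free_vars_graph:
  fixes P :: "(nat \<Rightarrow> 'a::field) set"
  assumes "affine_plane n d P" "free_vars n d P J"
  obtains c a where "\<And>x i. x \<in> P \<Longrightarrow> x i = c i + (\<Sum>j\<in>J. a i j * x j)"
    "\<And>i. i \<in> J \<Longrightarrow> c i = 0" "\<And>i j. i \<in> J \<Longrightarrow> j \<in> J \<Longrightarrow> a i j = (if i = j then 1 else 0)"
proof -
  obtain p V where pV: "p \<in> kn n" "V \<subseteq> kn n" "kv.subspace V" "P = (\<lambda>v. p + v) ` V"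
    using assms(1) by (auto simp: affine_plane_def)
  have finJ: "finite J" using assms(2) by (auto simp: free_vars_def intro: finite_subset)
  have "\<exists>w\<in>V. \<forall>i\<in>J. w i = (if i = j then 1 else 0)" for j
  proof -
    obtain x where "x \<in> P" "\<And>i. i \<in> J \<Longrightarrow> x i = p i + (if i = j then 1 else 0)"
      using free_vars_point[OF assms(2), of "\<lambda>i. p i + (if i = j then 1 else 0)"] by metis
    moreover from this obtain v where "v \<in> V" "x = p + v" using pV(4) by auto
    ultimately show ?thesis by (intro bexI[of _ v]) auto
  qed
  then obtain w where w: "\<And>j. w j \<in> V" "\<And>i j. i \<in> J \<Longrightarrow> w j i = (if i = j then 1 else 0)"
    by metis
  have delta: "(\<Sum>j\<in>J. w j i * y j) = y i" if "i \<in> J" for i y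
  proof -
    have "(\<Sum>j\<in>J. w j i * y j) = (\<Sum>j\<in>J. if j = i then y i else 0)"
      using w(2) that by (intro sum.cong) auto
    then show ?thesis using that finJ by simp
  qed
  \<comment> \<open>\<open>x\<close> and \<open>p + u\<close> are points of \<open>P\<close> with
    the same coordinates in \<open>J\<close>, hence equal.\<close>
  have graph: "x i = p i - (\<Sum>j\<in>J. w j i * p j) + (\<Sum>j\<in>J. w j i * x j)" if "x \<in> P" for x i
  proof -
    define u where "u = (\<Sum>j\<in>J. kscale (x j - p j) (w j))"
    have u: "u k = (\<Sum>j\<in>J. w j k * (x j - p j))" for k
      by (simp add: u_def sum_fun_apply kscale_def mult.commute)
    have "u \<in> V" unfolding u_def
      using pV(3) w(1) by (intro kv.subspace_sum kv.subspace_scale) auto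
    then have "p + u \<in> P" using pV(4) by auto
    then have "x = p + u"
      using that by (intro free_vars_eqI[OF assms(2)]) (auto simp: u delta)
    then have "x i = p i + u i" by (metis plus_fun_apply)
    then show ?thesis by (simp add: u right_diff_distrib sum_subtractf)
  qed
  show thesis
    by (rule that[of "\<lambda>i. p i - (\<Sum>j\<in>J. w j i * p j)" "\<lambda>i j. w j i"]) (use graph delta w(2) in auto)
qed

text \<open>If \<open>X_i\<close> depended on \<open>X_j\<close> with \<open>i < j\<close>, its
  equation could be solved for \<open>X_j\<close>, and exchanging \<open>j\<close> for
  \<open>i\<close> would give free variables again, against minimality.\<close>

lemma minimal_free_vars_triangular:
  fixes P :: "(nat \<Rightarrow> 'a::field) set"
  assumes "minimal_free_vars n d P J" "i < n" "i \<notin> J" "j \<in> J" "a j \<noteq> 0"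
    and graph: "\<And>x. x \<in> P \<Longrightarrow> x i = c + (\<Sum>j\<in>J. a j * x j)"
  shows "j < i"
proof (rule ccontr)
  assume "\<not> j < i"
  then have "i < j" using assms(3,4) by (metis linorder_neqE_nat)
  let ?K = "J - {j} \<union> {i}"
  have free: "free_vars n d P J" using assms(1) by (simp add: minimal_free_vars_def)
  have finJ: "finite J" using free by (auto simp: free_vars_def intro: finite_subset)
  have graph': "x i = c + (a j * x j + (\<Sum>k\<in>J - {j}. a k * x k))" if "x \<in> P" for x
    using graph[OF that] finJ assms(4) by (simp add: sum.remove)
  have "inj_on (\<lambda>x. restrict x ?K) P"
  proof (rule inj_onI)
    fix x y assume xy: "x \<in> P" "y \<in> P" "restrict x ?K = restrict y ?K"
    have eq: "x k = y k" if "k \<in> ?K" for k using fun_cong[OF xy(3), of k] that by simp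
    then have "(\<Sum>k\<in>J - {j}. a k * x k) = (\<Sum>k\<in>J - {j}. a k * y k)" by (intro sum.cong) auto
    then have "x j = y j" using graph'[OF xy(1)] graph'[OF xy(2)] eq[of i] assms(5) by simp
    then show "x = y" using eq xy by (intro free_vars_eqI[OF free]) auto
  qed
  moreover have "(\<lambda>x. restrict x ?K) ` P = PiE ?K (\<lambda>_. UNIV)"
  proof (intro equalityI subsetI)
    fix f :: "nat \<Rightarrow> 'a" assume f: "f \<in> PiE ?K (\<lambda>_. UNIV)"
    \<comment> \<open>The value at \<open>j\<close> is the one forced by solving the equation of
      \<open>X_i\<close> for \<open>X_j\<close>.\<close>
    define h where "h = f(j := (f i - c - (\<Sum>k\<in>J - {j}. a k * f k)) / a j)"
    obtain x where x: "x \<in> P" "\<And>k. k \<in> J \<Longrightarrow> x k = h k"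
      using free_vars_point[OF free, of h] by metis
    have "(\<Sum>k\<in>J - {j}. a k * x k) = (\<Sum>k\<in>J - {j}. a k * f k)"
      using x(2) by (intro sum.cong) (auto simp: h_def)
    then have "x i = f i" using graph'[OF x(1)] x(2)[OF assms(4)] assms(5) by (simp add: h_def)
    then have "restrict x ?K = f"
      using f x(2) by (auto simp: fun_eq_iff restrict_def PiE_def extensional_def h_def)
    then show "f \<in> (\<lambda>x. restrict x ?K) ` P" using x(1) by auto
  next
    fix f assume "f \<in> (\<lambda>x. restrict x ?K) ` P"
    then show "f \<in> PiE ?K (\<lambda>_. UNIV)"
      by (elim imageE, hypsubst, intro restrict_PiE_iff[THEN iffD2]) simp
  qed
  moreover have "card ?K = d" "?K \<subseteq> {..<n}"
    using free assms(2-4) finJ card_Suc_Diff1[of J j] by (auto simp: free_vars_def)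
  ultimately have "free_vars n d P ?K" by (simp add: free_vars_def bij_betw_def)
  then show False using assms \<open>i < j\<close> by (auto simp: minimal_free_vars_def)
qed

text \<open>The parameters are the variables \<open>X_j\<close> with \<open>j\<close> in
  \<open>J\<close> themselves, so substituting \<open>g\<close> fixes \<open>k[X_J]\<close>. The
  argument \<xi> ranges over all assignments, but only its values on \<open>J\<close>
  matter.\<close>

definition parametrization :: "nat set \<Rightarrow> (nat \<Rightarrow> 'a::comm_semiring_1 mpoly) \<Rightarrow> (nat \<Rightarrow> 'a) set \<Rightarrow> bool" where
  "parametrization J g P \<longleftrightarrow> P = range (\<lambda>\<xi> i. peval (g i) \<xi>) \<and>
     (\<forall>j\<in>J. g j = single (single j 1) 1) \<and>
     (\<forall>i. keys (g i) \<subseteq> insert 0 ((\<lambda>j. single j 1) ` J))"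

text \<open>The second property is the one that puts every exponent of \<open>g i\<close> strictly
  below \<open>single i 1\<close> when the variables increase in the term order.\<close>

lemma free_vars_parametrization:
  fixes P :: "(nat \<Rightarrow> 'a::field) set"
  assumes "affine_plane n d P" "free_vars n d P J"
  obtains g where "parametrization J g P"
    "minimal_free_vars n d P J \<longrightarrow>
      (\<forall>i<n. i \<notin> J \<longrightarrow> keys (g i) \<subseteq> insert 0 ((\<lambda>j. single j 1) ` {j\<in>J. j < i}))"
proof -
  obtain c a where graph: "\<And>x i. x \<in> P \<Longrightarrow> x i = c i + (\<Sum>j\<in>J. a i j * x j)"
    and ca: "\<And>i. i \<in> J \<Longrightarrow> c i = 0" "\<And>i j. i \<in> J \<Longrightarrow> j \<in> J \<Longrightarrow> a i j = (if i = j then 1 else 0)"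
    by (rule free_vars_graph[OF assms]) blast
  have finJ: "finite J" using assms(2) by (auto simp: free_vars_def intro: finite_subset)
  define g where "g i = single (0::expo) (c i) + (\<Sum>j\<in>J. single (single j (1::nat)) (a i j))" for i
  have g: "peval (g i) \<xi> = c i + (\<Sum>j\<in>J. a i j * \<xi> j)" for i \<xi>
    by (simp add: g_def peval_eq_geval ev.geval_add ev.geval_sum ev.geval_single meval_single)
  have keys_g: "keys (g i) \<subseteq> insert 0 ((\<lambda>j. single j 1) ` {j\<in>J. a i j \<noteq> 0})" for i
  proof -
    have "keys (g i) \<subseteq> keys (single (0::expo) (c i)) \<union> (\<Union>j\<in>J. keys (single (single j (1::nat)) (a i j)))"
      unfolding g_def by (rule order_trans[OF keys_add]) (intro Un_mono order_refl keys_sum)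
    also have "\<dots> \<subseteq> insert 0 ((\<lambda>j. single j 1) ` {j\<in>J. a i j \<noteq> 0})"
      by (auto split: if_splits)
    finally show ?thesis .
  qed
  have "P = range (\<lambda>\<xi> i. peval (g i) \<xi>)"
  proof (intro equalityI subsetI)
    fix x assume "x \<in> P"
    then have "x = (\<lambda>i. peval (g i) x)" using graph by (auto simp: g)
    then show "x \<in> range (\<lambda>\<xi> i. peval (g i) \<xi>)" by (intro image_eqI[where x = x]) simp_all
  next
    fix x assume "x \<in> range (\<lambda>\<xi> i. peval (g i) \<xi>)"
    then obtain \<xi> where \<xi>: "x = (\<lambda>i. peval (g i) \<xi>)" by auto
    obtain y where y: "y \<in> P" "\<And>j. j \<in> J \<Longrightarrow> y j = \<xi> j"
      using free_vars_point[OF assms(2), of \<xi>] by metis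
    have "x = y" using graph[OF y(1)] y(2) by (auto simp: \<xi> g)
    then show "x \<in> P" using y by simp
  qed
  moreover have "g i = single (single i 1) 1" if "i \<in> J" for i
  proof -
    have "(\<Sum>j\<in>J. single (single j (1::nat)) (a i j)) = (\<Sum>j\<in>J. if j = i then single (single i 1) 1 else 0)"
      using ca that by (intro sum.cong) auto
    then show ?thesis using that finJ ca by (simp add: g_def)
  qed
  ultimately have "parametrization J g P"
    using keys_g unfolding parametrization_def by blast
  moreover have "keys (g i) \<subseteq> insert 0 ((\<lambda>j. single j 1) ` {j\<in>J. j < i})"
    if "minimal_free_vars n d P J" "i < n" "i \<notin> J" for i
    using minimal_free_vars_triangular[OF that, of _ "a i" "c i"] graph keys_g[of i] by blast
  ultimately show thesis using that[of g] by blast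
qed

text \<open>Over an infinite field a polynomial that is zero at all parameter values is the zero
  polynomial, so vanishing on \<open>P\<close> turns into an identity of polynomials.\<close>

lemma parametrization_vanishes_iff:
  fixes g :: "nat \<Rightarrow> 'a::field mpoly"
  assumes "infinite (UNIV :: 'a set)" "parametrization J g P"
  shows "(\<forall>x\<in>P. peval f x = 0) \<longleftrightarrow> psub g f = 0"
proof
  assume "\<forall>x\<in>P. peval f x = 0"
  then show "psub g f = 0"
    using assms(2) by (intro peval_eq_0_imp_0[OF assms(1)]) (auto simp: peval_psub parametrization_def)
next
  assume "psub g f = 0"
  then have "peval f (\<lambda>i. peval (g i) \<xi>) = 0" for \<xi>
    using peval_psub[of g f \<xi>] by (simp add: peval_def)
  then show "\<forall>x\<in>P. peval f x = 0"
    using assms(2) by (auto simp: parametrization_def)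
qed

section \<open>Counting monomials by total degree\<close>

lemma lookup_const_mult: "lookup (single 0 c * p) \<beta> = c * lookup (p :: 'a::comm_semiring_1 mpoly) \<beta>"
  using lookup_single_mult[of 0 c p \<beta>] by simp

definition deg :: "expo \<Rightarrow> nat" where
  "deg \<alpha> = (\<Sum>i\<in>keys \<alpha>. lookup \<alpha> i)"

lemma deg_superset:
  assumes "finite K" "keys \<alpha> \<subseteq> K"
  shows "deg \<alpha> = (\<Sum>i\<in>K. lookup \<alpha> i)"
  unfolding deg_def using assms by (intro sum.mono_neutral_left) (auto simp: in_keys_iff)

lemma keys_add_nat: "keys (\<alpha> + \<beta> :: expo) = keys \<alpha> \<union> keys \<beta>"
  by (auto simp: in_keys_iff lookup_add)

lemma deg_0 [simp]: "deg 0 = 0"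
  by (simp add: deg_def)

lemma deg_add: "deg (\<alpha> + \<beta>) = deg \<alpha> + deg \<beta>"
  by (simp add: deg_superset[where K = "keys \<alpha> \<union> keys \<beta>"] keys_add_nat lookup_add sum.distrib)

lemma deg_single [simp]: "deg (single i m) = m"
  by (simp add: deg_def)

lemma deg_sum: "deg (\<Sum>i\<in>I. f i) = (\<Sum>i\<in>I. deg (f i))"
  by (induction I rule: infinite_finite_induct) (auto simp: deg_add)

lemma lookup_le_deg: "lookup \<alpha> i \<le> deg \<alpha>"
proof (cases "i \<in> keys \<alpha>")
  case True
  then show ?thesis unfolding deg_def by (intro member_le_sum) auto
qed (simp add: in_keys_iff)

lemma lookup_sum_single: "lookup (\<Sum>j\<in>J. single j (c j)) i = (if finite J \<and> i \<in> J then c i else (0::nat))"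
  by (cases "finite J") (auto simp: lookup_sum lookup_single when_def)

definition simplex :: "nat set \<Rightarrow> nat \<Rightarrow> expo set" where
  "simplex J t = {\<beta>. keys \<beta> \<subseteq> J \<and> deg \<beta> \<le> t}"

text \<open>Splitting off the exponent of \<open>j\<close> gives the recursion by which the simplex
  is counted.\<close>

lemma simplex_insert:
  assumes "j \<notin> J"
  shows "bij_betw (\<lambda>(b, \<beta>). single j b + \<beta>) (SIGMA b:{..t}. simplex J (t - b)) (simplex (insert j J) t)"
  unfolding bij_betw_def
proof
  have zero: "lookup \<beta> j = 0" if "keys \<beta> \<subseteq> J" for \<beta> :: expo
    using that assms by (auto simp: in_keys_iff)
  show "inj_on (\<lambda>(b, \<beta>). single j b + \<beta>) (SIGMA b:{..t}. simplex J (t - b))"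
  proof (rule inj_onI, clarify)
    fix b b' \<beta> \<beta>'
    assume "\<beta> \<in> simplex J (t - b)" "\<beta>' \<in> simplex J (t - b')"
      and eq: "single j b + \<beta> = single j b' + \<beta>'"
    then have "lookup \<beta> j = 0" "lookup \<beta>' j = 0" using zero by (auto simp: simplex_def)
    then have "b = b'"
      using arg_cong[OF eq, of "\<lambda>\<alpha>. lookup \<alpha> j"] by (simp add: lookup_add)
    then show "b = b' \<and> \<beta> = \<beta>'" using eq by simp
  qed
  show "(\<lambda>(b, \<beta>). single j b + \<beta>) ` (SIGMA b:{..t}. simplex J (t - b)) = simplex (insert j J) t"
  proof (intro equalityI subsetI)
    fix \<alpha> assume "\<alpha> \<in> (\<lambda>(b, \<beta>). single j b + \<beta>) ` (SIGMA b:{..t}. simplex J (t - b))"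
    then show "\<alpha> \<in> simplex (insert j J) t"
      by (auto simp: simplex_def deg_add keys_add_nat split: if_splits)
  next
    fix \<alpha> assume \<alpha>: "\<alpha> \<in> simplex (insert j J) t"
    define \<beta> where "\<beta> = \<alpha> - single j (lookup \<alpha> j)"
    have eq: "\<alpha> = single j (lookup \<alpha> j) + \<beta>"
      by (rule poly_mapping_eqI) (simp add: \<beta>_def lookup_add lookup_minus lookup_single when_def)
    have "deg \<alpha> = lookup \<alpha> j + deg \<beta>" by (subst eq) (simp add: deg_add)
    moreover have "keys \<beta> \<subseteq> J"
    proof
      fix i assume "i \<in> keys \<beta>"
      then have "i \<noteq> j" "i \<in> keys \<alpha>"
        by (auto simp: \<beta>_def in_keys_iff lookup_minus lookup_single when_def split: if_splits)
      then show "i \<in> J" using \<alpha> by (auto simp: simplex_def)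
    qed
    ultimately have "(lookup \<alpha> j, \<beta>) \<in> (SIGMA b:{..t}. simplex J (t - b))"
      using \<alpha> by (auto simp: simplex_def)
    then show "\<alpha> \<in> (\<lambda>(b, \<beta>). single j b + \<beta>) ` (SIGMA b:{..t}. simplex J (t - b))"
      using eq by (intro image_eqI[of _ _ "(lookup \<alpha> j, \<beta>)"]) auto
  qed
qed

text \<open>The recursion over the exponent of the new variable is the hockey-stick identity for
  binomial coefficients.\<close>

lemma card_simplex:
  assumes "finite J"
  shows "finite (simplex J t) \<and> card (simplex J t) = (card J + t) choose card J"
  using assms
proof (induction J arbitrary: t rule: finite_induct)
  case empty
  have "simplex {} t = {0}" by (auto simp: simplex_def)
  then show ?case by simp
next
  case (insert j J)
  let ?U = "SIGMA b:{..t}. simplex J (t - b)"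
  have "card ?U = (\<Sum>b\<le>t. (card J + (t - b)) choose card J)"
    using insert.IH by (simp add: card_SigmaI)
  also have "\<dots> = (\<Sum>b\<le>t. (card J + b) choose card J)"
    using sum.atLeastAtMost_rev[of "\<lambda>b. (card J + b) choose card J" 0 t] by (simp add: atLeast0AtMost)
  also have "\<dots> = (card (insert j J) + t) choose card (insert j J)"
    using insert.hyps choose_rising_sum(1)[of "card J" t] by simp
  finally have "card ?U = (card (insert j J) + t) choose card (insert j J)" .
  moreover have "finite ?U" using insert.IH by auto
  moreover have "bij_betw (\<lambda>(b, \<beta>). single j b + \<beta>) ?U (simplex (insert j J) t)"
    by (rule simplex_insert) (use insert.hyps in simp)
  ultimately show ?case by (metis bij_betw_finite bij_betw_same_card)
qed

text \<open>Shifting \<open>t\<close> by a constant multiplies the binomial coefficient by a factor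
  tending to 1, which cannot make up for the ratio of \<open>q + 1\<close> to
  \<open>q\<close>.\<close>

lemma binomial_growth:
  assumes "\<And>t. Suc q * (d + t choose d) \<le> q * (d + (t + c) choose d)"
  shows False
proof -
  \<comment> \<open>The exact quotient of consecutive binomial coefficients. It decreases in
    \<open>t\<close>, so \<open>c\<close> steps cost at most the factor
    \<open>r t ^ c\<close>.\<close>
  define r :: "nat \<Rightarrow> real" where "r t = 1 + real d / real (Suc t)" for t
  have step: "real (d + Suc t choose d) = r t * real (d + t choose d)" for t
  proof -
    have "Suc t * (d + Suc t choose d) = (d + Suc t) * (d + t choose d)"
      using binomial_absorb_comp[of "d + Suc t" d] by simp
    then have "real (Suc t) * real (d + Suc t choose d) = (real d + real (Suc t)) * real (d + t choose d)"
      by (metis of_nat_mult of_nat_add)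
    then show ?thesis by (simp add: r_def field_simps)
  qed
  have iter: "real (d + (t + c) choose d) \<le> r t ^ c * real (d + t choose d)" for t c
  proof (induction c)
    case (Suc c)
    have "r (t + c) \<le> r t" by (auto simp: r_def intro!: divide_left_mono)
    moreover have "0 \<le> r t ^ c * real (d + t choose d)" by (simp add: r_def)
    ultimately have "r (t + c) * real (d + (t + c) choose d) \<le> r t * (r t ^ c * real (d + t choose d))"
      using Suc by (intro mult_mono) (auto simp: r_def)
    then show ?case using step[of "t + c"] by simp
  qed simp
  have "real (Suc q) \<le> real q * r t ^ c" for t
  proof -
    have "real (Suc q) * real (d + t choose d) \<le> real q * real (d + (t + c) choose d)"
      using assms[of t] by (metis of_nat_le_iff of_nat_mult)
    also have "\<dots> \<le> real q * (r t ^ c * real (d + t choose d))"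
      by (intro mult_left_mono iter) auto
    finally have "real (Suc q) * real (d + t choose d) \<le> (real q * r t ^ c) * real (d + t choose d)"
      by (simp add: mult.assoc)
    then show ?thesis by (rule mult_right_le_imp_le) simp
  qed
  moreover have "(\<lambda>t. real q * r t ^ c) \<longlonglongrightarrow> real q * (1 + 0) ^ c"
    unfolding r_def
    by (intro tendsto_intros LIMSEQ_Suc[OF lim_const_over_n])
  ultimately have "real (Suc q) \<le> real q * (1 + 0) ^ c"
    by (intro LIMSEQ_le_const) auto
  then show False by simp
qed

section \<open>Leading exponents\<close>

context
  fixes n :: nat and lt :: "expo \<Rightarrow> expo \<Rightarrow> bool"
  assumes ord: "term_order n lt"
begin

lemma lt_irrefl: "\<alpha> \<in> mons n \<Longrightarrow> \<not> lt \<alpha> \<alpha>"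
  using ord unfolding term_order_def by blast

lemma lt_trans: "lt \<alpha> \<beta> \<Longrightarrow> lt \<beta> \<gamma> \<Longrightarrow> \<alpha> \<in> mons n \<Longrightarrow> \<beta> \<in> mons n \<Longrightarrow> \<gamma> \<in> mons n \<Longrightarrow> lt \<alpha> \<gamma>"
  using ord unfolding term_order_def by blast

lemma lt_total: "\<alpha> \<in> mons n \<Longrightarrow> \<beta> \<in> mons n \<Longrightarrow> \<alpha> = \<beta> \<or> lt \<alpha> \<beta> \<or> lt \<beta> \<alpha>"
  using ord unfolding term_order_def by blast

lemma lt_zero: "\<alpha> \<in> mons n \<Longrightarrow> \<alpha> \<noteq> 0 \<Longrightarrow> lt 0 \<alpha>"
  using ord unfolding term_order_def by blast

lemma lt_add: "lt \<alpha> \<beta> \<Longrightarrow> \<alpha> \<in> mons n \<Longrightarrow> \<beta> \<in> mons n \<Longrightarrow> \<gamma> \<in> mons n \<Longrightarrow> lt (\<alpha> + \<gamma>) (\<beta> + \<gamma>)"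
  using ord unfolding term_order_def by blast

lemma finite_has_greatest:
  assumes "finite K" "K \<noteq> {}" "K \<subseteq> mons n"
  shows "\<exists>\<alpha>\<in>K. \<forall>\<beta>\<in>K. \<beta> \<noteq> \<alpha> \<longrightarrow> lt \<beta> \<alpha>"
  using assms
proof (induction K rule: finite_ne_induct)
  case (insert \<alpha>0 K)
  then obtain \<alpha> where \<alpha>: "\<alpha> \<in> K" "\<forall>\<beta>\<in>K. \<beta> \<noteq> \<alpha> \<longrightarrow> lt \<beta> \<alpha>" by auto
  consider "lt \<alpha>0 \<alpha>" | "lt \<alpha> \<alpha>0" using lt_total[of \<alpha> \<alpha>0] \<alpha>(1) insert by auto
  then show ?case
  proof cases
    case 2
    have "lt \<beta> \<alpha>0" if "\<beta> \<in> K" for \<beta>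
      using 2 \<alpha> that insert.prems by (cases "\<beta> = \<alpha>") (auto intro: lt_trans[of \<beta> \<alpha>])
    then show ?thesis by auto
  qed (use \<alpha> in auto)
qed simp

lemma lead_exp:
  assumes "poly_in n f" "f \<noteq> 0"
  shows "lead_exp lt f \<in> keys f" "\<And>\<beta>. \<beta> \<in> keys f \<Longrightarrow> \<beta> \<noteq> lead_exp lt f \<Longrightarrow> lt \<beta> (lead_exp lt f)"
proof -
  have mons: "keys f \<subseteq> mons n" using assms(1) by (simp add: poly_in_def)
  obtain \<alpha> where \<alpha>: "\<alpha> \<in> keys f" "\<forall>\<beta>\<in>keys f. \<beta> \<noteq> \<alpha> \<longrightarrow> lt \<beta> \<alpha>"
    using finite_has_greatest[OF _ _ mons] assms(2) by auto
  have "lead_exp lt f = \<alpha>"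
    unfolding lead_exp_def
  proof (rule the_equality)
    fix \<alpha>' assume \<alpha>': "\<alpha>' \<in> keys f \<and> (\<forall>\<beta>\<in>keys f. \<beta> \<noteq> \<alpha>' \<longrightarrow> lt \<beta> \<alpha>')"
    show "\<alpha>' = \<alpha>"
    proof (rule ccontr)
      assume "\<alpha>' \<noteq> \<alpha>"
      then have "lt \<alpha>' \<alpha>" "lt \<alpha> \<alpha>'" "\<alpha> \<in> mons n" "\<alpha>' \<in> mons n" using \<alpha> \<alpha>' mons by auto
      then show False using lt_trans[of \<alpha> \<alpha>' \<alpha>] lt_irrefl[of \<alpha>] by simp
    qed
  qed (use \<alpha> in auto)
  then show "lead_exp lt f \<in> keys f" "\<And>\<beta>. \<beta> \<in> keys f \<Longrightarrow> \<beta> \<noteq> lead_exp lt f \<Longrightarrow> lt \<beta> (lead_exp lt f)"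
    using \<alpha> by auto
qed

end

section \<open>Planes of exponents and their apices\<close>

definition cone :: "expo \<Rightarrow> nat set \<Rightarrow> expo set" where
  "cone \<gamma> J = {\<gamma> + \<beta> | \<beta>. keys \<beta> \<subseteq> J}"

definition apices :: "nat \<Rightarrow> expo set \<Rightarrow> nat set \<Rightarrow> expo set" where
  "apices n D J = {\<gamma>\<in>mons n. (\<forall>j\<in>J. lookup \<gamma> j = 0) \<and> cone \<gamma> J \<subseteq> D}"

lemma planes_in_eq: "planes_in n D J = (\<lambda>\<gamma>. cone \<gamma> J) ` apices n D J"
  by (auto simp: planes_in_def apices_def cone_def)

text \<open>The apex is the only point of its plane with all coordinates in \<open>J\<close> equal
  to 0. Counting planes therefore amounts to counting apices.\<close>

lemma inj_on_cone: "inj_on (\<lambda>\<gamma>. cone \<gamma> J) (apices n D J)"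
proof (rule inj_onI)
  fix \<gamma> \<gamma>' assume \<gamma>: "\<gamma> \<in> apices n D J" "\<gamma>' \<in> apices n D J" and eq: "cone \<gamma> J = cone \<gamma>' J"
  have "\<gamma> + 0 \<in> cone \<gamma> J" unfolding cone_def by fastforce
  then obtain \<beta> where \<beta>: "\<gamma> = \<gamma>' + \<beta>" "keys \<beta> \<subseteq> J" unfolding eq by (auto simp: cone_def)
  have "lookup \<beta> i = 0" for i
    using \<beta> \<gamma> by (cases "i \<in> J") (auto simp: apices_def lookup_add in_keys_iff)
  then have "\<beta> = 0" by (intro poly_mapping_eqI) simp
  then show "\<gamma> = \<gamma>'" using \<beta> by simp
qed

section \<open>The number of d-planes is at most the number of components\<close>

lemma keys_mult_simplex:
  assumes "keys p \<subseteq> simplex J s" "keys q \<subseteq> simplex J t"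
  shows "keys (p * q :: 'a::comm_semiring_1 mpoly) \<subseteq> simplex J (s + t)"
proof
  fix \<alpha> assume "\<alpha> \<in> keys (p * q)"
  then obtain a b where "\<alpha> = a + b" "a \<in> keys p" "b \<in> keys q" using keys_mult[of p q] by blast
  moreover have "a \<in> simplex J s" "b \<in> simplex J t" using assms calculation by auto
  ultimately show "\<alpha> \<in> simplex J (s + t)" by (auto simp: simplex_def keys_add_nat deg_add)
qed

lemma keys_power_simplex:
  "keys p \<subseteq> simplex J s \<Longrightarrow> keys (p ^ m :: 'a::comm_semiring_1 mpoly) \<subseteq> simplex J (m * s)"
proof (induction m)
  case (Suc m)
  then show ?case using keys_mult_simplex[of p J s "p ^ m" "m * s"] by simp
qed (simp add: simplex_def)

lemma keys_prod_simplex: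
  assumes "\<And>i. i \<in> I \<Longrightarrow> keys (p i) \<subseteq> simplex J (s i)"
  shows "keys (\<Prod>i\<in>I. p i :: 'a::comm_semiring_1 mpoly) \<subseteq> simplex J (\<Sum>i\<in>I. s i)"
  using assms
proof (induction I rule: infinite_finite_induct)
  case (insert i I)
  then show ?case using keys_mult_simplex[of "p i" J "s i" "prod p I"] by simp
qed (simp_all add: simplex_def)

text \<open>Substituting affine forms does not raise the total degree.\<close>

lemma parametrization_meval_simplex:
  fixes g :: "nat \<Rightarrow> 'a::comm_semiring_1 mpoly"
  assumes "parametrization J g P"
  shows "keys (meval g \<alpha>) \<subseteq> simplex J (deg \<alpha>)"
proof -
  have "keys (g i) \<subseteq> simplex J 1" for i
  proof -
    have "keys (g i) \<subseteq> insert 0 ((\<lambda>j. single j 1) ` J)" using assms by (simp add: parametrization_def)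
    also have "\<dots> \<subseteq> simplex J 1" by (auto simp: simplex_def)
    finally show ?thesis .
  qed
  from keys_power_simplex[OF this] have "keys (g i ^ lookup \<alpha> i) \<subseteq> simplex J (lookup \<alpha> i)" for i
    by fastforce
  then show ?thesis unfolding meval_def deg_def by (intro keys_prod_simplex)
qed

text \<open>All directions \<open>J\<close> are bounded together, since planes of different
  directions draw on the same functions on the components. \<Gamma> is an arbitrary finite family of
  planes because finiteness of the set of all apices is not known beforehand.\<close>

lemma card_apices_le:
  fixes S :: "(nat \<Rightarrow> 'a::field) set set"
  assumes inf: "infinite (UNIV :: 'a set)" and ord: "term_order n lt"
    and S: "finite S" "\<forall>P\<in>S. affine_plane n d P"
    and \<Gamma>: "finite \<Gamma>"
      "\<And>J \<gamma>. (J, \<gamma>) \<in> \<Gamma> \<Longrightarrow> J \<subseteq> {..<n} \<and> card J = d \<and> \<gamma> \<in> apices n (D_set n lt (\<Union>S)) J"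
  shows "card \<Gamma> \<le> card S"
proof (rule ccontr)
  assume more: "\<not> card \<Gamma> \<le> card S"
  have "\<exists>J g. finite J \<and> card J = d \<and> parametrization J g P" if "P \<in> S" for P
  proof -
    have aff: "affine_plane n d P" using S that by simp
    then obtain J where J: "free_vars n d P J" by (rule affine_plane_has_free_vars)
    moreover from aff J obtain g where "parametrization J g P" by (rule free_vars_parametrization)
    ultimately show ?thesis by (auto simp: free_vars_def intro: finite_subset)
  qed
  then obtain JJ gg where par: "\<And>P. P \<in> S \<Longrightarrow> finite (JJ P) \<and> card (JJ P) = d \<and> parametrization (JJ P) (gg P) P"
    by metis
  \<comment> \<open>Larger than the degree, hence than every coordinate, of each apex in
    \<Gamma>.\<close>
  define c where "c = Suc (\<Sum>(J, \<gamma>)\<in>\<Gamma>. deg \<gamma>)"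
  have small_deg: "deg \<gamma> < c" if "(J, \<gamma>) \<in> \<Gamma>" for J \<gamma>
    using member_le_sum[of "(J, \<gamma>)" \<Gamma> "\<lambda>(J, \<gamma>). deg \<gamma>"] that \<Gamma>(1) by (auto simp: c_def)
  have small: "lookup \<gamma> i < c" if "(J, \<gamma>) \<in> \<Gamma>" for J \<gamma> i
    using small_deg[OF that] lookup_le_deg[of \<gamma> i] by simp
  have finJ: "finite J" if "(J, \<gamma>) \<in> \<Gamma>" for J \<gamma>
    using \<Gamma>(2)[OF that] by (auto intro: finite_subset)
  \<comment> \<open>Each plane is entered only after moving by \<open>c\<close> in all its
    directions. Then \<open>J\<close> is the set of coordinates that are at least \<open>c\<close>,
    and the other coordinates give \<gamma>, so the shifted simplices are disjoint.\<close>
  define e where "e = (\<lambda>((J :: nat set, \<gamma> :: expo), \<beta> :: expo). \<gamma> + (\<Sum>j\<in>J. single j c) + \<beta>)"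
  define U where "U t = (SIGMA z:\<Gamma>. simplex (fst z) t)" for t
  \<comment> \<open>Bounds the degree of an apex plus the shift by \<open>c\<close> in
    \<open>d\<close> directions; it does not depend on \<open>t\<close>.\<close>
  define C where "C = c + d * c"
  have lookup_e: "lookup (e ((J, \<gamma>), \<beta>)) i = (if i \<in> J then c + lookup \<beta> i else lookup \<gamma> i)"
    if "(J, \<gamma>) \<in> \<Gamma>" "keys \<beta> \<subseteq> J" for J \<gamma> \<beta> i
    using that \<Gamma>(2)[OF that(1)] finJ[OF that(1)]
    by (auto simp: e_def lookup_add lookup_sum_single apices_def in_keys_iff)
  have inj_e: "inj_on e (U t)" for t
  proof (rule inj_onI)
    fix u u' assume uu: "u \<in> U t" "u' \<in> U t" "e u = e u'"
    obtain J \<gamma> \<beta> J' \<gamma>' \<beta>' where u: "u = ((J, \<gamma>), \<beta>)" "u' = ((J', \<gamma>'), \<beta>')"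
      by (metis prod.exhaust)
    note U = uu(1,2)[unfolded u] and eq = uu(3)[unfolded u]
    have in_\<Gamma>: "(J, \<gamma>) \<in> \<Gamma>" "keys \<beta> \<subseteq> J" "(J', \<gamma>') \<in> \<Gamma>" "keys \<beta>' \<subseteq> J'"
      using U by (auto simp: U_def simplex_def)
    have lk: "(if i \<in> J then c + lookup \<beta> i else lookup \<gamma> i) = (if i \<in> J' then c + lookup \<beta>' i else lookup \<gamma>' i)" for i
      using arg_cong[OF eq, of "\<lambda>\<alpha>. lookup \<alpha> i"] lookup_e in_\<Gamma> by simp
    have "J = J'"
    proof (rule set_eqI)
      fix i show "i \<in> J \<longleftrightarrow> i \<in> J'"
        using lk[of i] small[OF in_\<Gamma>(1), of i] small[OF in_\<Gamma>(3), of i] by (auto split: if_splits)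
    qed
    moreover have "lookup \<gamma> i = lookup \<gamma>' i" for i
      using lk[of i] \<Gamma>(2)[OF in_\<Gamma>(1)] \<Gamma>(2)[OF in_\<Gamma>(3)] \<open>J = J'\<close> by (auto simp: apices_def split: if_splits)
    then have "\<gamma> = \<gamma>'" by (intro poly_mapping_eqI) simp
    ultimately show "u = u'" using eq by (simp add: u e_def)
  qed
  have e_D: "e u \<in> D_set n lt (\<Union>S)" if "u \<in> U t" for u t
  proof -
    obtain J \<gamma> \<beta> where u: "u = ((J, \<gamma>), \<beta>)" by (metis prod.exhaust)
    have in_\<Gamma>: "(J, \<gamma>) \<in> \<Gamma>" "keys \<beta> \<subseteq> J" using that u by (auto simp: U_def simplex_def)
    have "keys ((\<Sum>j\<in>J. single j c) + \<beta>) \<subseteq> J"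
      using in_\<Gamma>(2) by (auto simp: keys_add_nat in_keys_iff lookup_sum_single split: if_splits)
    then have "e u \<in> cone \<gamma> J"
      unfolding cone_def u e_def by (auto simp: add.assoc)
    then show ?thesis using \<Gamma>(2)[OF in_\<Gamma>(1)] by (auto simp: apices_def)
  qed
  have deg_e: "deg (e u) \<le> t + C" if "u \<in> U t" for u t
  proof -
    obtain J \<gamma> \<beta> where u: "u = ((J, \<gamma>), \<beta>)" by (metis prod.exhaust)
    have in_\<Gamma>: "(J, \<gamma>) \<in> \<Gamma>" "deg \<beta> \<le> t" using that u by (auto simp: U_def simplex_def)
    have "deg (e u) = deg \<gamma> + d * c + deg \<beta>"
      using \<Gamma>(2)[OF in_\<Gamma>(1)] by (simp add: u e_def deg_add deg_sum)
    then show ?thesis using small_deg[OF in_\<Gamma>(1)] in_\<Gamma>(2) by (simp add: C_def)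
  qed
  have "card \<Gamma> * (d + t choose d) \<le> card S * (d + (t + C) choose d)" for t
  proof -
    \<comment> \<open>One equation for each component and each exponent that can occur in a
      restriction of degree at most \<open>t + C\<close>.\<close>
    define E where "E = (SIGMA P:S. simplex (JJ P) (t + C))"
    have card_U: "card (U t) = card \<Gamma> * (d + t choose d)" "finite (U t)"
    proof -
      have "finite (simplex (fst z) t) \<and> card (simplex (fst z) t) = (d + t choose d)" if "z \<in> \<Gamma>" for z
        using that card_simplex[of "fst z" t] finJ[of "fst z" "snd z"] \<Gamma>(2)[of "fst z" "snd z"] by simp
      then show "card (U t) = card \<Gamma> * (d + t choose d)" "finite (U t)"
        unfolding U_def using \<Gamma>(1) by auto
    qed
    have card_E: "card E = card S * (d + (t + C) choose d)" "finite E"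
      unfolding E_def using S(1) par card_simplex by auto
    \<comment> \<open>With more monomials than equations, a nonzero combination of monomials from
      \<open>D(A)\<close> would vanish on every component, and its leading exponent would lie in
      both \<open>C(A)\<close> and \<open>D(A)\<close>.\<close>
    have "\<not> card E < card (U t)"
    proof
      assume "card E < card (U t)"
      from underdetermined_system[OF card_E(2) card_U(2) this, of UNIV "\<lambda>(P, \<beta>) u. lookup (meval (gg P) (e u)) \<beta>"]
      obtain l where l: "\<exists>u\<in>U t. l u \<noteq> 0"
        "\<And>P \<beta>. (P, \<beta>) \<in> E \<Longrightarrow> (\<Sum>u\<in>U t. lookup (meval (gg P) (e u)) \<beta> * l u) = 0" by fastforce
      define f where "f = (\<Sum>u\<in>U t. single (e u) (l u))"
      obtain u0 where u0: "u0 \<in> U t" "l u0 \<noteq> 0" using l by auto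
      have "lookup f (e u0) = (\<Sum>u\<in>U t. if u = u0 then l u0 else 0)"
        unfolding f_def lookup_sum using inj_e[of t] u0
        by (intro sum.cong) (auto simp: lookup_single when_def inj_on_def)
      then have "f \<noteq> 0" using u0 card_U(2) by auto
      have keys_f: "keys f \<subseteq> D_set n lt (\<Union>S)"
      proof -
        have "keys f \<subseteq> (\<Union>u\<in>U t. keys (single (e u) (l u)))" unfolding f_def by (rule keys_sum)
        then show ?thesis using e_D by (auto split: if_splits)
      qed
      have "psub (gg P) f = 0" if "P \<in> S" for P
      proof (rule poly_mapping_eqI)
        fix \<beta>
        have "psub (gg P) f = (\<Sum>u\<in>U t. single 0 (l u) * meval (gg P) (e u))"
          by (simp add: f_def sb.geval_sum sb.geval_single)
        then have eq: "lookup (psub (gg P) f) \<beta> = (\<Sum>u\<in>U t. l u * lookup (meval (gg P) (e u)) \<beta>)"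
          by (simp add: lookup_sum lookup_const_mult)
        show "lookup (psub (gg P) f) \<beta> = lookup 0 \<beta>"
        proof (cases "\<beta> \<in> simplex (JJ P) (t + C)")
          case True
          then have "(P, \<beta>) \<in> E" using that by (simp add: E_def)
          from l(2)[OF this] show ?thesis unfolding eq by (simp add: mult.commute)
        next
          case False
          have "lookup (meval (gg P) (e u)) \<beta> = 0" if "u \<in> U t" for u
          proof (rule ccontr)
            assume "lookup (meval (gg P) (e u)) \<beta> \<noteq> 0"
            then have "\<beta> \<in> keys (meval (gg P) (e u))" by (simp add: in_keys_iff)
            then have "\<beta> \<in> simplex (JJ P) (deg (e u))"
              using parametrization_meval_simplex par \<open>P \<in> S\<close> by blast
            then show False using False deg_e[OF that] by (simp add: simplex_def)
          qed
          then show ?thesis using eq by simp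
        qed
      qed
      then have "\<forall>x\<in>P. peval f x = 0" if "P \<in> S" for P
        using parametrization_vanishes_iff[OF inf, of "JJ P" "gg P" P f] par[OF that] that by simp
      then have "f \<in> vanishing_ideal n (\<Union>S)"
        using keys_f by (auto simp: vanishing_ideal_def poly_in_def D_set_def)
      then have "lead_exp lt f \<in> C_set n lt (\<Union>S)" "poly_in n f"
        using \<open>f \<noteq> 0\<close> by (auto simp: C_set_def vanishing_ideal_def)
      then show False using lead_exp(1)[OF ord _ \<open>f \<noteq> 0\<close>] keys_f by (auto simp: D_set_def)
    qed
    then show ?thesis using card_U card_E by simp
  qed
  moreover have "Suc (card S) * (d + t choose d) \<le> card \<Gamma> * (d + t choose d)" for t
    using more by (intro mult_right_mono) auto
  ultimately have "Suc (card S) * (d + t choose d) \<le> card S * (d + (t + C) choose d)" for t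
    by (rule order_trans[rotated])
  then show False by (rule binomial_growth)
qed

section \<open>The number of d-planes with given directions is at least the number of components\<close>

definition leq :: "(expo \<Rightarrow> expo \<Rightarrow> bool) \<Rightarrow> expo \<Rightarrow> expo \<Rightarrow> bool" where
  "leq lt \<alpha> \<beta> \<longleftrightarrow> \<alpha> = \<beta> \<or> lt \<alpha> \<beta>"

lemma mons_add [simp]: "\<alpha> + \<beta> \<in> mons n \<longleftrightarrow> \<alpha> \<in> mons n \<and> \<beta> \<in> mons n"
  by (auto simp: mons_def keys_add_nat)

lemma mons_single: "i < n \<Longrightarrow> single i m \<in> mons n"
  by (simp add: mons_def)

context
  fixes n :: nat and lt :: "expo \<Rightarrow> expo \<Rightarrow> bool"
  assumes ord: "term_order n lt"
begin

lemma lt_add_mono: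
  assumes "lt \<alpha> \<beta>" "lt \<gamma> \<delta>" "\<alpha> \<in> mons n" "\<beta> \<in> mons n" "\<gamma> \<in> mons n" "\<delta> \<in> mons n"
  shows "lt (\<alpha> + \<gamma>) (\<beta> + \<delta>)"
proof (rule lt_trans[OF ord])
  show "lt (\<alpha> + \<gamma>) (\<beta> + \<gamma>)" using lt_add[OF ord] assms by simp
  show "lt (\<beta> + \<gamma>) (\<beta> + \<delta>)" using lt_add[OF ord, of \<gamma> \<delta> \<beta>] assms by (simp add: add.commute)
qed (use assms in auto)

lemma leq_add_mono:
  assumes "leq lt \<alpha> \<beta>" "leq lt \<gamma> \<delta>" "\<alpha> \<in> mons n" "\<beta> \<in> mons n" "\<gamma> \<in> mons n" "\<delta> \<in> mons n"
  shows "leq lt (\<alpha> + \<gamma>) (\<beta> + \<delta>)"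
  using assms lt_add_mono[of \<alpha> \<beta> \<gamma> \<delta>] lt_add[OF ord, of \<alpha> \<beta> \<gamma>] lt_add[OF ord, of \<gamma> \<delta> \<beta>]
  by (auto simp: leq_def add.commute)

lemma leq_lt_add_mono:
  assumes "leq lt \<alpha> \<beta>" "lt \<gamma> \<delta>" "\<alpha> \<in> mons n" "\<beta> \<in> mons n" "\<gamma> \<in> mons n" "\<delta> \<in> mons n"
  shows "lt (\<alpha> + \<gamma>) (\<beta> + \<delta>)"
  using assms lt_add_mono[of \<alpha> \<beta> \<gamma> \<delta>] lt_add[OF ord, of \<gamma> \<delta> \<beta>]
  by (auto simp: leq_def add.commute)

lemma not_leq:
  assumes "\<alpha> \<in> mons n" "\<beta> \<in> mons n"
  shows "\<not> leq lt \<alpha> \<beta> \<longleftrightarrow> lt \<beta> \<alpha>"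
  using assms lt_total[OF ord assms] lt_irrefl[OF ord] lt_trans[OF ord, of \<alpha> \<beta> \<alpha>] by (auto simp: leq_def)

lemma leq_lead_exp:
  assumes "poly_in n p" "\<kappa> \<in> keys p"
  shows "leq lt \<kappa> (lead_exp lt p)"
proof -
  have "p \<noteq> 0" using assms(2) by auto
  then show ?thesis using lead_exp(2)[OF ord assms(1)] assms(2) by (auto simp: leq_def)
qed

text \<open>\<open>leq lt (L \<gamma> + \<gamma>') (L \<gamma>' + \<gamma>)\<close> compares the differences \<open>L \<gamma> - \<gamma>\<close> in the ordered group of integer vectors.\<close>

lemma excess_trans:
  assumes "leq lt (L \<gamma>1 + \<gamma>2) (L \<gamma>2 + \<gamma>1)" "leq lt (L \<gamma>2 + \<gamma>3) (L \<gamma>3 + \<gamma>2)"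
    and "\<gamma>1 \<in> mons n" "\<gamma>2 \<in> mons n" "\<gamma>3 \<in> mons n" "L \<gamma>1 \<in> mons n" "L \<gamma>2 \<in> mons n" "L \<gamma>3 \<in> mons n"
  shows "leq lt (L \<gamma>1 + \<gamma>3) (L \<gamma>3 + \<gamma>1)"
proof (rule ccontr)
  assume "\<not> ?thesis"
  then have less: "lt (L \<gamma>3 + \<gamma>1) (L \<gamma>1 + \<gamma>3)" using not_leq assms by simp
  \<comment> \<open>Adding both assumptions and the negated conclusion produces the same exponent on
    both sides of a strict inequality.\<close>
  have sum: "leq lt ((L \<gamma>1 + \<gamma>2) + (L \<gamma>2 + \<gamma>3)) ((L \<gamma>2 + \<gamma>1) + (L \<gamma>3 + \<gamma>2))"
    by (rule leq_add_mono[OF assms(1,2)]) (use assms in simp_all)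
  have "lt (((L \<gamma>1 + \<gamma>2) + (L \<gamma>2 + \<gamma>3)) + (L \<gamma>3 + \<gamma>1)) (((L \<gamma>2 + \<gamma>1) + (L \<gamma>3 + \<gamma>2)) + (L \<gamma>1 + \<gamma>3))"
    by (rule leq_lt_add_mono[OF sum less]) (use assms in simp_all)
  moreover have "((L \<gamma>1 + \<gamma>2) + (L \<gamma>2 + \<gamma>3)) + (L \<gamma>3 + \<gamma>1) = ((L \<gamma>2 + \<gamma>1) + (L \<gamma>3 + \<gamma>2)) + (L \<gamma>1 + \<gamma>3)"
    by (simp add: add_ac)
  ultimately show False using lt_irrefl[OF ord] assms by simp
qed

lemma excess_max:
  assumes "finite G" "G \<noteq> {}" "\<And>\<gamma>. \<gamma> \<in> G \<Longrightarrow> \<gamma> \<in> mons n \<and> L \<gamma> \<in> mons n"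
  shows "\<exists>\<gamma>0\<in>G. \<forall>\<gamma>\<in>G. leq lt (L \<gamma> + \<gamma>0) (L \<gamma>0 + \<gamma>)"
  using assms
proof (induction G rule: finite_ne_induct)
  case (singleton x)
  then show ?case by (simp add: leq_def)
next
  case (insert x G)
  then obtain \<gamma>0 where \<gamma>0: "\<gamma>0 \<in> G" "\<forall>\<gamma>\<in>G. leq lt (L \<gamma> + \<gamma>0) (L \<gamma>0 + \<gamma>)" by auto
  have mons: "x \<in> mons n" "L x \<in> mons n" "\<gamma>0 \<in> mons n" "L \<gamma>0 \<in> mons n" using insert.prems \<gamma>0(1) by auto
  show ?case
  proof (cases "leq lt (L x + \<gamma>0) (L \<gamma>0 + x)")
    case True
    then show ?thesis using \<gamma>0 by auto
  next
    case False
    then have "lt (L \<gamma>0 + x) (L x + \<gamma>0)" using not_leq mons by simp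
    then have x: "leq lt (L \<gamma>0 + x) (L x + \<gamma>0)" by (simp add: leq_def)
    have "leq lt (L \<gamma> + x) (L x + \<gamma>)" if "\<gamma> \<in> G" for \<gamma>
      using excess_trans[of L \<gamma> \<gamma>0 x] x \<gamma>0(2) that insert.prems mons by auto
    then show ?thesis by (auto simp: leq_def)
  qed
qed

text \<open>With \<open>q P\<close> the restriction of \<open>X_i\<close> to \<open>P\<close>, the
  product vanishes on all components and so is a common integral equation of \<open>X_i\<close> over
  \<open>k[X_J]\<close>. Its tail is smaller in two ways: a lower power of \<open>X_i\<close>, which
  drives an induction on degree, and a smaller exponent in the term order.\<close>

lemma monic_product_tail:
  fixes q :: "'b \<Rightarrow> 'a::comm_ring_1 mpoly"
  assumes "finite T" "i < n" "J \<subseteq> {..<n}"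
    and "\<And>P. P \<in> T \<Longrightarrow> keys (q P) \<subseteq> {\<epsilon>. keys \<epsilon> \<subseteq> J \<and> lt \<epsilon> (single i 1)}"
  shows "\<exists>h. (\<Prod>P\<in>T. single (single i 1) 1 - q P) = single (single i (card T)) 1 + h \<and>
    keys h \<subseteq> {single i r + \<epsilon> | r \<epsilon>. r < card T \<and> keys \<epsilon> \<subseteq> J \<and> lt (single i r + \<epsilon>) (single i (card T))}"
  using assms(1,4)
proof (induction T rule: finite_induct)
  case empty
  then show ?case by (intro exI[of _ 0]) simp
next
  case (insert P T)
  define m where "m = card T"
  let ?H = "\<lambda>m. {single i r + \<epsilon> | r \<epsilon>. r < m \<and> keys \<epsilon> \<subseteq> J \<and> lt (single i r + \<epsilon>) (single i m)}"
  define X where "X = (single (single i 1) 1 :: 'a mpoly)"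
  obtain h where h: "(\<Prod>P\<in>T. X - q P) = single (single i m) 1 + h" "keys h \<subseteq> ?H m"
    using insert by (auto simp: m_def X_def)
  have q: "keys (q P) \<subseteq> {\<epsilon>. keys \<epsilon> \<subseteq> J \<and> lt \<epsilon> (single i 1)}" using insert.prems by simp
  have mons: "\<epsilon> \<in> mons n" if "keys \<epsilon> \<subseteq> J" for \<epsilon> using that assms(3) by (auto simp: mons_def)
  note mons_i = mons_single[OF assms(2)]
  have split: "single i (Suc r) = single i 1 + single i r" for r :: nat
    by (simp flip: single_add)
  have card: "card (insert P T) = Suc m" using insert.hyps by (simp add: m_def)
  define h' where "h' = X * h - q P * single (single i m) 1 - q P * h"
  have "(\<Prod>P\<in>insert P T. X - q P) = single (single i (Suc m)) 1 + h'"
  proof -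
    have "(\<Prod>P\<in>insert P T. X - q P) = (X - q P) * (single (single i m) 1 + h)"
      using insert.hyps h(1) by simp
    also have "\<dots> = X * single (single i m) 1 + h'" by (simp add: h'_def algebra_simps)
    also have "X * single (single i m) 1 = single (single i (Suc m)) 1"
      unfolding split by (simp add: X_def mult_single)
    finally show ?thesis .
  qed
  moreover have "keys h' \<subseteq> ?H (Suc m)"
  proof
    fix \<alpha> assume "\<alpha> \<in> keys h'"
    then have "\<alpha> \<in> keys (X * h) \<or> \<alpha> \<in> keys (q P * single (single i m) 1) \<or> \<alpha> \<in> keys (q P * h)"
      using keys_diff[of "X * h - q P * single (single i m) 1" "q P * h"]
        keys_diff[of "X * h" "q P * single (single i m) 1"] unfolding h'_def by auto
    then consider (Xh) "\<alpha> \<in> keys (X * h)" | (lX) "\<alpha> \<in> keys (q P * single (single i m) 1)"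
      | (lh) "\<alpha> \<in> keys (q P * h)" by blast
    then show "\<alpha> \<in> ?H (Suc m)"
    proof cases
      case Xh
      then obtain \<delta> where "\<alpha> = single i 1 + \<delta>" "\<delta> \<in> keys h"
        using keys_single_mult[of "single i 1" 1 h] by (auto simp: X_def)
      then obtain r \<epsilon> where r: "\<alpha> = single i (Suc r) + \<epsilon>" "r < m" "keys \<epsilon> \<subseteq> J"
        "lt (single i r + \<epsilon>) (single i m)"
        using h(2) unfolding split by (auto simp: add.assoc)
      have "lt (single i r + \<epsilon> + single i 1) (single i m + single i 1)"
        using r mons mons_i by (intro lt_add[OF ord]) auto
      then have "lt (single i (Suc r) + \<epsilon>) (single i (Suc m))" unfolding split by (simp add: add_ac)
      then show ?thesis using r by auto
    next
      case lX
      then obtain \<epsilon> where r: "\<alpha> = single i m + \<epsilon>" "\<epsilon> \<in> keys (q P)"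
        using keys_single_mult[of "single i m" 1 "q P"] by (auto simp: mult.commute)
      then have "keys \<epsilon> \<subseteq> J" "lt (\<epsilon> + single i m) (single i 1 + single i m)"
        using q mons mons_i by (auto intro!: lt_add[OF ord])
      then have "lt (single i m + \<epsilon>) (single i (Suc m))" unfolding split by (simp add: add_ac)
      then show ?thesis using r \<open>keys \<epsilon> \<subseteq> J\<close> by auto
    next
      case lh
      then obtain \<epsilon>' \<delta> where "\<alpha> = \<epsilon>' + \<delta>" "\<epsilon>' \<in> keys (q P)" "\<delta> \<in> keys h"
        using keys_mult[of "q P" h] by blast
      moreover from this obtain r \<epsilon> where "\<delta> = single i r + \<epsilon>" "r < m" "keys \<epsilon> \<subseteq> J"
        "lt (single i r + \<epsilon>) (single i m)"
        using h(2) by blast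
      ultimately have r: "\<alpha> = single i r + (\<epsilon> + \<epsilon>')" "r < m" "keys \<epsilon> \<subseteq> J" "keys \<epsilon>' \<subseteq> J"
        "lt (single i r + \<epsilon>) (single i m)" "lt \<epsilon>' (single i 1)"
        using q by (auto simp: add_ac)
      have "lt (\<epsilon>' + (single i r + \<epsilon>)) (single i 1 + single i m)"
        by (rule lt_add_mono[OF r(6,5)]) (use r mons mons_i in simp_all)
      then have "lt (single i r + (\<epsilon> + \<epsilon>')) (single i (Suc m))" unfolding split by (simp add: add_ac)
      moreover have "keys (\<epsilon> + \<epsilon>') \<subseteq> J" using r by (simp add: keys_add_nat)
      ultimately show ?thesis using r(1,2) by (auto intro: less_SucI)
    qed
  qed
  ultimately show ?case unfolding card X_def by blast
qed

end

section \<open>Substitution of a parametrization\<close>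

lemma meval_variables: "meval (\<lambda>i. single (single i 1) 1) \<beta> = (single \<beta> 1 :: 'a::comm_semiring_1 mpoly)"
proof -
  have power: "single (single i 1) 1 ^ m = (single (single i m) 1 :: 'a mpoly)" for i :: nat and m :: nat
  proof (induction m)
    case (Suc m)
    have "single i (Suc m) = single i 1 + single i m" by (simp flip: single_add)
    then show ?case using Suc by (simp add: mult_single)
  qed simp
  have prod: "(\<Prod>i\<in>I. single (f i) 1) = (single (\<Sum>i\<in>I. f i) 1 :: 'a mpoly)" for I :: "nat set" and f :: "nat \<Rightarrow> expo"
    by (induction I rule: infinite_finite_induct) (auto simp: mult_single)
  show ?thesis unfolding meval_def power prod sum_singles ..
qed

text \<open>The source of \<open>k[X_J]\<close>-linearity: monomials in the free variables pass
  unchanged through every restriction map.\<close>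

lemma parametrization_meval:
  assumes "parametrization J g P" "keys \<beta> \<subseteq> J"
  shows "meval g \<beta> = single \<beta> 1"
proof -
  have "meval g \<beta> = meval (\<lambda>i. single (single i 1) 1) \<beta>"
    unfolding meval_def using assms by (intro prod.cong) (auto simp: parametrization_def)
  then show ?thesis by (simp only: meval_variables)
qed

lemma parametrization_psub_id:
  fixes g :: "nat \<Rightarrow> 'a::comm_semiring_1 mpoly"
  assumes "parametrization J g P" "\<And>\<alpha>. \<alpha> \<in> keys p \<Longrightarrow> keys \<alpha> \<subseteq> J"
  shows "psub g p = p"
proof -
  have "psub g p = (\<Sum>\<alpha>\<in>keys p. single \<alpha> (lookup p \<alpha>))"
    unfolding sb.geval_def using assms by (intro sum.cong) (auto simp: parametrization_meval mult_single)
  then show ?thesis by (simp add: sum_singles)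
qed

lemma split_off_J:
  fixes \<alpha> :: expo
  obtains \<gamma> \<beta> where "\<alpha> = \<gamma> + \<beta>" "\<forall>j\<in>J. lookup \<gamma> j = 0" "keys \<beta> \<subseteq> J"
proof -
  define \<beta> where "\<beta> = (\<Sum>j\<in>keys \<alpha> \<inter> J. single j (lookup \<alpha> j))"
  have \<beta>: "lookup \<beta> i = (if i \<in> J then lookup \<alpha> i else 0)" for i
    by (auto simp: \<beta>_def lookup_sum_single in_keys_iff)
  show thesis
  proof (rule that[of "\<alpha> - \<beta>" \<beta>])
    show "\<alpha> = \<alpha> - \<beta> + \<beta>"
      by (rule poly_mapping_eqI) (simp add: lookup_add lookup_minus \<beta>)
    show "\<forall>j\<in>J. lookup (\<alpha> - \<beta>) j = 0" by (simp add: lookup_minus \<beta>)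
    show "keys \<beta> \<subseteq> J" using \<beta> by (auto simp: in_keys_iff split: if_splits)
  qed
qed

lemma poly_in_diff: "poly_in n p \<Longrightarrow> poly_in n q \<Longrightarrow> poly_in n (p - q :: 'a::comm_ring_1 mpoly)"
  using keys_diff[of p q] by (auto simp: poly_in_def)

lemma poly_in_mult: "poly_in n p \<Longrightarrow> poly_in n q \<Longrightarrow> poly_in n (p * q :: 'a::comm_ring_1 mpoly)"
  using keys_mult[of p q] by (fastforce simp: poly_in_def)

lemma poly_in_sum: "(\<And>i. i \<in> I \<Longrightarrow> poly_in n (f i)) \<Longrightarrow> poly_in n (\<Sum>i\<in>I. f i :: 'a::comm_ring_1 mpoly)"
  using keys_sum[of f I] by (fastforce simp: poly_in_def)

lemma poly_in_1 [simp]: "poly_in n (1 :: 'a::comm_ring_1 mpoly)"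
  by (simp add: poly_in_def mons_def)

lemma poly_in_prod: "(\<And>i. i \<in> I \<Longrightarrow> poly_in n (f i)) \<Longrightarrow> poly_in n (\<Prod>i\<in>I. f i :: 'a::comm_ring_1 mpoly)"
  by (induction I rule: infinite_finite_induct) (auto intro: poly_in_mult)

lemma affine_plane_subset_kn: "affine_plane n d P \<Longrightarrow> P \<subseteq> kn n"
  by (auto simp: affine_plane_def kn_def)

lemma prod_nonzero:
  fixes f :: "'i \<Rightarrow> 'r::idom"
  assumes "finite I" "\<And>i. i \<in> I \<Longrightarrow> f i \<noteq> 0"
  shows "prod f I \<noteq> 0"
  using assms by (simp add: prod_zero_iff)

lemma card_apices_ge:
  fixes T :: "(nat \<Rightarrow> 'a::field) set set" and A :: "(nat \<Rightarrow> 'a) set"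
  assumes inf: "infinite (UNIV :: 'a set)" and ord: "term_order n lt" and incr: "vars_increasing n lt"
    and J: "J \<subseteq> {..<n}" and T: "finite T" "\<Union>T \<subseteq> A"
    and planes: "\<And>P. P \<in> T \<Longrightarrow> affine_plane n d P" "\<And>P. P \<in> T \<Longrightarrow> minimal_free_vars n d P J"
    and fin: "finite (apices n (D_set n lt A) J)"
  shows "card T \<le> card (apices n (D_set n lt A) J)"
proof (rule ccontr)
  assume less: "\<not> ?thesis"
  have mons_J: "\<epsilon> \<in> mons n" if "keys \<epsilon> \<subseteq> J" for \<epsilon> using that J by (auto simp: mons_def)
  have "\<exists>g. parametrization J g P \<and> (\<forall>i<n. i \<notin> J \<longrightarrow> keys (g i) \<subseteq> insert 0 ((\<lambda>j. single j 1) ` {j\<in>J. j < i}))"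
    if P: "P \<in> T" for P
  proof -
    from planes(2)[OF P] have "free_vars n d P J" by (simp add: minimal_free_vars_def)
    with planes(1)[OF P] obtain g where "parametrization J g P"
      "minimal_free_vars n d P J \<longrightarrow>
        (\<forall>i<n. i \<notin> J \<longrightarrow> keys (g i) \<subseteq> insert 0 ((\<lambda>j. single j 1) ` {j\<in>J. j < i}))"
      by (rule free_vars_parametrization)
    then show ?thesis using planes(2)[OF P] by blast
  qed
  then obtain g where par: "\<And>P. P \<in> T \<Longrightarrow> parametrization J (g P) P"
    and tri: "\<And>P i. P \<in> T \<Longrightarrow> i < n \<Longrightarrow> i \<notin> J \<Longrightarrow> keys (g P i) \<subseteq> insert 0 ((\<lambda>j. single j 1) ` {j\<in>J. j < i})"
    by metis
  have keys_g: "keys \<epsilon> \<subseteq> J" if "P \<in> T" "\<epsilon> \<in> keys (g P i)" for P i \<epsilon>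
    using par[OF that(1)] that(2) by (fastforce simp: parametrization_def)
  \<comment> \<open>Triangularity of minimal free variables meets the order of the variables
    here.\<close>
  have lt_g: "lt \<epsilon> (single i 1)" if "P \<in> T" "i < n" "i \<notin> J" "\<epsilon> \<in> keys (g P i)" for P i \<epsilon>
  proof -
    have "single i 1 \<noteq> (0::expo)" by (metis lookup_single_eq lookup_zero zero_neq_one)
    then have "lt 0 (single i 1)" using that(2) by (intro lt_zero[OF ord] mons_single)
    moreover have "lt (single j 1) (single i 1)" if "j < i" for j
      using incr that \<open>i < n\<close> by (simp add: vars_increasing_def)
    ultimately show ?thesis using tri[OF that(1-3)] that(4) by blast
  qed
  have psub_g: "psub (g P) (g P i) = g P i" if "P \<in> T" for P i
    using parametrization_psub_id[OF par[OF that]] keys_g[OF that] by blast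
  have psub_X: "psub (g P) (single (single i 1) 1) = g P i" for P i
    by (simp add: sb.geval_single meval_single)
  have meval_in: "poly_in n (meval (g P) \<alpha>)" if "P \<in> T" for P \<alpha>
    using parametrization_meval_simplex[OF par[OF that], of \<alpha>] mons_J
    by (auto simp: poly_in_def simplex_def)

  have "card (apices n (D_set n lt A) J) < card T" using less by simp
  \<comment> \<open>The apices give the equations and the components the unknowns. Solutions are
    sought among polynomials in \<open>n\<close> variables, so that all exponents stay where the
    term order is a total order.\<close>
  then have "\<exists>l. (\<forall>P\<in>T. l P \<in> {p. poly_in n p}) \<and> (\<exists>P\<in>T. l P \<noteq> 0) \<and>
      (\<forall>\<gamma>\<in>apices n (D_set n lt A) J. (\<Sum>P\<in>T. meval (g P) \<gamma> * l P) = 0)"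
    using meval_in
    by (intro underdetermined_system fin T(1)) (auto intro: poly_in_diff poly_in_mult)
  then obtain l where l_in: "\<And>P. P \<in> T \<Longrightarrow> poly_in n (l P)" and l_nz: "\<exists>P\<in>T. l P \<noteq> 0"
    and l_apices: "\<And>\<gamma>. \<gamma> \<in> apices n (D_set n lt A) J \<Longrightarrow> (\<Sum>P\<in>T. meval (g P) \<gamma> * l P) = 0"
    by auto
  define \<Lambda> where "\<Lambda> f = (\<Sum>P\<in>T. psub (g P) f * l P)" for f
  define \<mu> where "\<mu> \<alpha> = \<Lambda> (single \<alpha> 1)" for \<alpha>
  have \<mu>: "\<mu> \<alpha> = (\<Sum>P\<in>T. meval (g P) \<alpha> * l P)" for \<alpha>
    by (simp add: \<mu>_def \<Lambda>_def sb.geval_single)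
  have \<mu>_in: "poly_in n (\<mu> \<alpha>)" for \<alpha>
    unfolding \<mu> using meval_in l_in by (intro poly_in_sum poly_in_mult) auto
  have \<Lambda>_add: "\<Lambda> (f + f') = \<Lambda> f + \<Lambda> f'" for f f'
    by (simp add: \<Lambda>_def sb.geval_add distrib_right sum.distrib)
  have \<Lambda>_expand: "\<Lambda> (single \<beta> 1 * f) = (\<Sum>\<alpha>\<in>keys f. single 0 (lookup f \<alpha>) * \<mu> (\<beta> + \<alpha>))" for \<beta> f
  proof -
    have "\<Lambda> (single \<beta> 1 * f) = (\<Sum>P\<in>T. \<Sum>\<alpha>\<in>keys f. single 0 (lookup f \<alpha>) * (meval (g P) (\<beta> + \<alpha>) * l P))"
      unfolding \<Lambda>_def sb.geval_mult sb.geval_single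
      by (simp add: sb.geval_def sum_distrib_left sum_distrib_right meval_add mult_ac)
    also have "\<dots> = (\<Sum>\<alpha>\<in>keys f. single 0 (lookup f \<alpha>) * \<mu> (\<beta> + \<alpha>))"
      unfolding \<mu> sum_distrib_left by (rule sum.swap)
    finally show ?thesis .
  qed
  \<comment> \<open>Linearity over \<open>k[X_J]\<close> reduces \<mu> to exponents that are zero on
    \<open>J\<close>.\<close>
  have \<mu>_J: "\<mu> (\<gamma> + \<beta>) = single \<beta> 1 * \<mu> \<gamma>" if "keys \<beta> \<subseteq> J" for \<gamma> \<beta>
    unfolding \<mu> sum_distrib_left
    using parametrization_meval[OF par that] by (intro sum.cong) (auto simp: meval_add mult_ac)
  have key_transfer: "\<exists>\<delta>\<in>keys f. \<kappa> \<in> keys (\<mu> (\<beta> + \<delta>))" if "\<kappa> \<in> keys (\<Lambda> (single \<beta> 1 * f))" for \<kappa> \<beta> f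
  proof -
    have "lookup (\<Lambda> (single \<beta> 1 * f)) \<kappa> = (\<Sum>\<alpha>\<in>keys f. lookup f \<alpha> * lookup (\<mu> (\<beta> + \<alpha>)) \<kappa>)"
      unfolding \<Lambda>_expand lookup_sum lookup_const_mult ..
    then have "(\<Sum>\<alpha>\<in>keys f. lookup f \<alpha> * lookup (\<mu> (\<beta> + \<alpha>)) \<kappa>) \<noteq> 0" using that by (simp add: in_keys_iff)
    then obtain \<delta> where "\<delta> \<in> keys f" "lookup f \<delta> * lookup (\<mu> (\<beta> + \<delta>)) \<kappa> \<noteq> 0"
      by (rule sum.not_neutral_contains_not_neutral)
    then show ?thesis by (intro bexI[of _ \<delta>]) (auto simp: in_keys_iff)
  qed

  define NZ where "NZ = {\<gamma>\<in>mons n. (\<forall>j\<in>J. lookup \<gamma> j = 0) \<and> \<mu> \<gamma> \<noteq> 0}"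
  define L where "L \<gamma> = lead_exp lt (\<mu> \<gamma>)" for \<gamma>
  have L: "L \<gamma> \<in> keys (\<mu> \<gamma>)" "L \<gamma> \<in> mons n" if "\<gamma> \<in> NZ" for \<gamma>
    using lead_exp(1)[OF ord \<mu>_in, of \<gamma>] \<mu>_in[of \<gamma>] that by (auto simp: L_def NZ_def poly_in_def)
  have L_max: "leq lt \<kappa> (L \<gamma>)" if "\<kappa> \<in> keys (\<mu> \<gamma>)" for \<kappa> \<gamma>
    unfolding L_def using leq_lead_exp[OF ord \<mu>_in that] .
  have keys_\<mu>_mons: "\<kappa> \<in> mons n" if "\<kappa> \<in> keys (\<mu> \<gamma>)" for \<kappa> \<gamma>
    using \<mu>_in[of \<gamma>] that by (auto simp: poly_in_def)

  text \<open>Distinct components are separated by products of linear forms, so \<open>\<Lambda>\<close> does not vanish.\<close>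
  have "NZ \<noteq> {}"
  proof -
    obtain P0 where P0: "P0 \<in> T" "l P0 \<noteq> 0" using l_nz by auto
    \<comment> \<open>Coordinates from \<open>n\<close> on vanish on every plane, so planes whose
      forms agree below \<open>n\<close> coincide.\<close>
    have "\<exists>i<n. g P i \<noteq> g P0 i" if P: "P \<in> T" "P \<noteq> P0" for P
    proof (rule ccontr)
      assume "\<not> ?thesis"
      then have eq: "g P i = g P0 i" if "i < n" for i using that by auto
      have "(\<lambda>i. peval (g P i) \<xi>) = (\<lambda>i. peval (g P0 i) \<xi>)" for \<xi>
      proof (rule ext)
        fix i
        have "(\<lambda>i. peval (g P i) \<xi>) \<in> kn n" "(\<lambda>i. peval (g P0 i) \<xi>) \<in> kn n"
          using par P(1) P0(1) affine_plane_subset_kn[OF planes(1)] by (force simp: parametrization_def)+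
        then show "peval (g P i) \<xi> = peval (g P0 i) \<xi>" using eq by (cases "i < n") (auto simp: kn_def)
      qed
      then have "P = P0" using par[OF P(1)] par[OF P0(1)] by (simp add: parametrization_def)
      then show False using P by simp
    qed
    then obtain ix where ix: "\<And>P. P \<in> T \<Longrightarrow> P \<noteq> P0 \<Longrightarrow> ix P < n \<and> g P (ix P) \<noteq> g P0 (ix P)" by metis
    define u where "u = (\<Prod>P\<in>T - {P0}. single (single (ix P) 1) 1 - g P (ix P))"
    have psub_u: "psub (g Q) u = (\<Prod>P\<in>T - {P0}. g Q (ix P) - g P (ix P))" if "Q \<in> T" for Q
      unfolding u_def sb.geval_prod psub_diff psub_X
      using parametrization_psub_id[OF par[OF that]] keys_g by (intro prod.cong) auto
    have "psub (g Q) u = 0" if "Q \<in> T" "Q \<noteq> P0" for Q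
      unfolding psub_u[OF that(1)] using that T(1) by auto
    moreover have u0: "psub (g P0) u \<noteq> 0"
    proof -
      have "g P0 (ix P) - g P (ix P) \<noteq> 0" if "P \<in> T - {P0}" for P using ix[of P] that by (metis DiffE insertCI right_minus_eq)
      then show ?thesis
        unfolding psub_u[OF P0(1)] by (intro prod_nonzero finite_Diff T(1))
    qed
    ultimately have "\<Lambda> u = psub (g P0) u * l P0"
      unfolding \<Lambda>_def using T(1) P0(1) by (subst sum.remove[of _ P0]) auto
    then have "\<Lambda> u \<noteq> 0" using u0 P0(2) by simp
    then obtain \<kappa> where "\<kappa> \<in> keys (\<Lambda> (single 0 1 * u))" by force
    then obtain \<alpha> where \<alpha>: "\<alpha> \<in> keys u" "\<kappa> \<in> keys (\<mu> (0 + \<alpha>))" using key_transfer by blast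
    have "poly_in n u" unfolding u_def
    proof (intro poly_in_prod poly_in_diff)
      fix P assume P: "P \<in> T - {P0}"
      then show "poly_in n (single (single (ix P) 1) 1)"
        using ix by (auto simp: poly_in_def mons_def)
      show "poly_in n (g P (ix P))"
        using keys_g[of P] P mons_J by (auto simp: poly_in_def)
    qed
    then have "\<alpha> \<in> mons n" using \<alpha> by (auto simp: poly_in_def)
    \<comment> \<open>The part of \<alpha> in \<open>J\<close> can be stripped without losing
      nonvanishing, by linearity over \<open>k[X_J]\<close>.\<close>
    obtain \<gamma> \<beta> where split: "\<alpha> = \<gamma> + \<beta>" "\<forall>j\<in>J. lookup \<gamma> j = 0" "keys \<beta> \<subseteq> J" by (rule split_off_J)
    have "\<mu> \<gamma> \<noteq> 0" using \<alpha>(2) \<mu>_J[OF split(3), of \<gamma>] split(1) by auto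
    then have "\<gamma> \<in> NZ" using split \<open>\<alpha> \<in> mons n\<close> by (simp add: NZ_def)
    then show ?thesis by auto
  qed

  define m where "m = card T"
  \<comment> \<open>Each difference \<open>L \<gamma> - \<gamma>\<close> is dominated by one from a
    finite box, which is why a maximum exists. The induction trades a factor \<open>X_i^m\<close>
    for the tail of its monic equation, lowering the degree.\<close>
  have box: "\<exists>\<gamma>'\<in>NZ. (\<forall>i. lookup \<gamma>' i < m) \<and> leq lt (L \<gamma> + \<gamma>') (L \<gamma>' + \<gamma>)" if "\<gamma> \<in> NZ" for \<gamma>
    using that
  proof (induction "deg \<gamma>" arbitrary: \<gamma> rule: less_induct)
    case less
    note \<gamma> = \<open>\<gamma> \<in> NZ\<close>
    \<comment> \<open>A coordinate that is at least \<open>m\<close> is then nonzero, which forces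
      \<open>i < n\<close> and \<open>i \<notin> J\<close>.\<close>
    have "m > 0" using l_nz T(1) by (auto simp: m_def card_gt_0_iff)
    show ?case
    proof (cases "\<forall>i. lookup \<gamma> i < m")
      case True
      then show ?thesis using \<gamma> by (auto simp: leq_def)
    next
      case False
      then obtain i where i: "m \<le> lookup \<gamma> i" by (auto simp: not_less)
      have "i \<in> keys \<gamma>" using i \<open>m > 0\<close> by (auto simp: in_keys_iff)
      then have "i < n" using \<gamma> by (auto simp: NZ_def mons_def)
      have "i \<notin> J" using \<gamma> i \<open>m > 0\<close> by (auto simp: NZ_def)
      define \<gamma>0 where "\<gamma>0 = \<gamma> - single i m"
      have split: "\<gamma> = \<gamma>0 + single i m"
        by (rule poly_mapping_eqI) (use i in \<open>auto simp: \<gamma>0_def lookup_add lookup_minus lookup_single when_def\<close>)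
      have \<gamma>0: "\<gamma>0 \<in> mons n" "\<forall>j\<in>J. lookup \<gamma>0 j = 0"
        using \<gamma> \<open>i < n\<close> by (auto simp: NZ_def split mons_single lookup_add)
      obtain h where h: "(\<Prod>P\<in>T. single (single i 1) 1 - g P i) = single (single i m) 1 + h"
        "keys h \<subseteq> {single i r + \<epsilon> | r \<epsilon>. r < m \<and> keys \<epsilon> \<subseteq> J \<and> lt (single i r + \<epsilon>) (single i m)}"
        using monic_product_tail[OF ord T(1) \<open>i < n\<close> J, of "\<lambda>P. g P i"] keys_g lt_g \<open>i < n\<close> \<open>i \<notin> J\<close>
        unfolding m_def by blast
      \<comment> \<open>On \<open>P\<close> the factor belonging to \<open>P\<close> becomes
        zero.\<close>
      have "psub (g P) (single (single i m) 1 + h) = 0" if "P \<in> T" for P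
        unfolding h(1)[symmetric] sb.geval_prod psub_diff psub_X
        using that T(1) by (intro prod_zero bexI[of _ P]) (simp_all add: psub_g)
      then have "\<Lambda> (single \<gamma>0 1 * (single (single i m) 1 + h)) = 0"
        unfolding \<Lambda>_def sb.geval_mult by simp
      then have "\<mu> \<gamma> + \<Lambda> (single \<gamma>0 1 * h) = 0"
        by (simp add: distrib_left \<Lambda>_add mult_single \<mu>_def split)
      then have "\<mu> \<gamma> = - \<Lambda> (single \<gamma>0 1 * h)" by (simp add: eq_neg_iff_add_eq_0)
      then have "L \<gamma> \<in> keys (\<Lambda> (single \<gamma>0 1 * h))" using L(1)[OF \<gamma>] by simp
      then obtain \<delta> where \<delta>: "\<delta> \<in> keys h" "L \<gamma> \<in> keys (\<mu> (\<gamma>0 + \<delta>))" using key_transfer by blast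
      then obtain r \<epsilon> where r: "\<delta> = single i r + \<epsilon>" "r < m" "keys \<epsilon> \<subseteq> J"
        "lt (single i r + \<epsilon>) (single i m)" using h(2) by blast
      define \<gamma>1 where "\<gamma>1 = \<gamma>0 + single i r"
      have "\<mu> (\<gamma>0 + \<delta>) = single \<epsilon> 1 * \<mu> \<gamma>1"
        using \<mu>_J[OF r(3), of \<gamma>1] by (simp add: \<gamma>1_def r(1) add_ac)
      then obtain \<kappa> where \<kappa>: "L \<gamma> = \<epsilon> + \<kappa>" "\<kappa> \<in> keys (\<mu> \<gamma>1)"
        using \<delta>(2) keys_single_mult[of \<epsilon> 1 "\<mu> \<gamma>1"] by auto
      have \<gamma>1: "\<gamma>1 \<in> NZ"
        using \<gamma>0 \<kappa>(2) \<open>i < n\<close> \<open>i \<notin> J\<close>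
        by (auto simp: NZ_def \<gamma>1_def mons_single lookup_add lookup_single when_def)
      have "deg \<gamma>1 < deg \<gamma>" using r(2) by (simp add: \<gamma>1_def split deg_add)
      from less.hyps[OF this \<gamma>1] obtain \<gamma>' where
        \<gamma>': "\<gamma>' \<in> NZ" "\<forall>i. lookup \<gamma>' i < m" "leq lt (L \<gamma>1 + \<gamma>') (L \<gamma>' + \<gamma>1)" by auto
      have mons: "\<epsilon> \<in> mons n" "\<kappa> \<in> mons n" "L \<gamma>1 \<in> mons n" "single i r \<in> mons n" "single i m \<in> mons n"
        using mons_J[OF r(3)] keys_\<mu>_mons[OF \<kappa>(2)] L(2)[OF \<gamma>1] mons_single[OF \<open>i < n\<close>] by auto
      \<comment> \<open>Since \<kappa> is at most \<open>L \<gamma>1\<close> and the tail exponent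
        is below \<open>single i m\<close>, the difference \<open>L \<gamma> - \<gamma>\<close> is
        less than \<open>L \<gamma>1 - \<gamma>1\<close>.\<close>
      have "lt ((\<kappa> + \<gamma>0) + (single i r + \<epsilon>)) ((L \<gamma>1 + \<gamma>0) + single i m)"
      proof (rule leq_lt_add_mono[OF ord _ r(4)])
        show "leq lt (\<kappa> + \<gamma>0) (L \<gamma>1 + \<gamma>0)"
          by (rule leq_add_mono[OF ord L_max[OF \<kappa>(2)]]) (use mons \<gamma>0 in \<open>simp_all add: leq_def\<close>)
      qed (use mons \<gamma>0 in simp_all)
      moreover have "(\<kappa> + \<gamma>0) + (single i r + \<epsilon>) = L \<gamma> + \<gamma>1"
        unfolding \<kappa>(1) by (simp add: \<gamma>1_def add_ac)
      moreover have "(L \<gamma>1 + \<gamma>0) + single i m = L \<gamma>1 + \<gamma>"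
        unfolding split by (simp add: add.assoc)
      ultimately have "leq lt (L \<gamma> + \<gamma>1) (L \<gamma>1 + \<gamma>)"
        by (simp only: leq_def simp_thms)
      then have "leq lt (L \<gamma> + \<gamma>') (L \<gamma>' + \<gamma>)"
        by (rule excess_trans[OF ord _ \<gamma>'(3)]) (use \<gamma> \<gamma>1 \<gamma>'(1) L(2) in \<open>auto simp: NZ_def\<close>)
      then show ?thesis using \<gamma>' by blast
    qed
  qed

  define G where "G = {\<gamma>\<in>NZ. \<forall>i. lookup \<gamma> i < m}"
  have "finite G"
  proof (rule finite_subset)
    show "G \<subseteq> simplex {..<n} (n * m)"
    proof
      fix \<gamma> assume "\<gamma> \<in> G"
      then have *: "keys \<gamma> \<subseteq> {..<n}" "\<And>i. lookup \<gamma> i \<le> m"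
        by (auto simp: G_def NZ_def mons_def intro: less_imp_le)
      have "deg \<gamma> = (\<Sum>i<n. lookup \<gamma> i)" by (rule deg_superset) (use * in auto)
      also have "\<dots> \<le> n * m" using sum_bounded_above[of "{..<n}" "lookup \<gamma>" m] *(2) by simp
      finally show "\<gamma> \<in> simplex {..<n} (n * m)" using * by (simp add: simplex_def)
    qed
    show "finite (simplex {..<n} (n * m))" using card_simplex by blast
  qed
  have "G \<noteq> {}" using \<open>NZ \<noteq> {}\<close> box by (auto simp: G_def)
  have "\<gamma> \<in> mons n \<and> L \<gamma> \<in> mons n" if "\<gamma> \<in> G" for \<gamma>
    using that L(2) by (simp add: G_def NZ_def)
  from excess_max[OF ord \<open>finite G\<close> \<open>G \<noteq> {}\<close>, of L, OF this]
  obtain \<gamma>s where \<gamma>s: "\<gamma>s \<in> G" "\<forall>\<gamma>\<in>G. leq lt (L \<gamma> + \<gamma>s) (L \<gamma>s + \<gamma>)" by blast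
  have \<gamma>s_NZ: "\<gamma>s \<in> NZ" using \<gamma>s(1) by (simp add: G_def)
  \<comment> \<open>Domination by the box extends maximality from \<open>G\<close> to all of
    \<open>NZ\<close>.\<close>
  have max: "leq lt (L \<gamma> + \<gamma>s) (L \<gamma>s + \<gamma>)" if \<gamma>: "\<gamma> \<in> NZ" for \<gamma>
  proof -
    obtain \<gamma>' where \<gamma>': "\<gamma>' \<in> NZ" "\<gamma>' \<in> G" "leq lt (L \<gamma> + \<gamma>') (L \<gamma>' + \<gamma>)"
      using box[OF \<gamma>] by (auto simp: G_def)
    show ?thesis
      by (rule excess_trans[OF ord \<gamma>'(3)]) (use \<gamma> \<gamma>' \<gamma>s \<gamma>s_NZ L(2) in \<open>auto simp: NZ_def\<close>)
  qed

  \<comment> \<open>Apices are killed by \<Lambda>, whereas \<open>\<mu> \<gamma>s\<close> is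
    nonzero.\<close>
  have "\<gamma>s \<notin> apices n (D_set n lt A) J"
    using l_apices[of \<gamma>s] \<gamma>s_NZ by (auto simp: \<mu> NZ_def)
  then obtain \<beta> where \<beta>: "keys \<beta> \<subseteq> J" "\<gamma>s + \<beta> \<notin> D_set n lt A"
    using \<gamma>s_NZ by (auto simp: apices_def NZ_def cone_def)
  then have "\<gamma>s + \<beta> \<in> C_set n lt A" using \<gamma>s_NZ mons_J by (auto simp: D_set_def NZ_def)
  then obtain f where f: "f \<in> vanishing_ideal n A" "f \<noteq> 0" "lead_exp lt f = \<gamma>s + \<beta>"
    by (auto simp: C_set_def)
  have f_in: "poly_in n f" using f(1) by (simp add: vanishing_ideal_def)
  have "psub (g P) f = 0" if "P \<in> T" for P
    using parametrization_vanishes_iff[OF inf par[OF that], of f] f(1) T(2) that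
    by (auto simp: vanishing_ideal_def)
  then have "\<Lambda> f = 0" by (simp add: \<Lambda>_def)
  define f' where "f' = f - single (\<gamma>s + \<beta>) (lookup f (\<gamma>s + \<beta>))"
  define c where "c = lookup f (\<gamma>s + \<beta>)"
  have c: "c \<noteq> 0" using lead_exp(1)[OF ord f_in f(2)] f(3) by (simp add: c_def in_keys_iff)
  have keys_f': "\<delta> \<in> mons n \<and> lt \<delta> (\<gamma>s + \<beta>)" if "\<delta> \<in> keys f'" for \<delta>
  proof -
    have "\<delta> \<in> keys f" "\<delta> \<noteq> \<gamma>s + \<beta>"
      using that by (auto simp: f'_def in_keys_iff lookup_minus lookup_single when_def split: if_splits)
    then show ?thesis using lead_exp(2)[OF ord f_in f(2)] f(3) f_in by (auto simp: poly_in_def)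
  qed
  have "single (\<gamma>s + \<beta>) c = single 0 c * single (\<gamma>s + \<beta>) 1" by (simp add: mult_single)
  then have "\<Lambda> (single (\<gamma>s + \<beta>) c) = single 0 c * \<mu> (\<gamma>s + \<beta>)"
    by (simp add: \<Lambda>_def \<mu>_def sb.geval_mult sb.geval_single sum_distrib_left mult_ac)
  moreover have "\<Lambda> f = \<Lambda> (single (\<gamma>s + \<beta>) c) + \<Lambda> f'"
    by (simp add: f'_def c_def flip: \<Lambda>_add)
  ultimately have eq: "single 0 c * \<mu> (\<gamma>s + \<beta>) = - \<Lambda> f'"
    using \<open>\<Lambda> f = 0\<close> by (simp add: eq_neg_iff_add_eq_0)
  \<comment> \<open>The leading term of \<open>f\<close> contributes a nonzero coefficient at
    \<open>\<beta> + L \<gamma>s\<close>. As \<open>\<Lambda> f = 0\<close>, some smaller exponent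
    \<delta> of \<open>f\<close> must contribute there as well.\<close>
  have "lookup (single 0 c * \<mu> (\<gamma>s + \<beta>)) (\<beta> + L \<gamma>s) = c * lookup (\<mu> \<gamma>s) (L \<gamma>s)"
    unfolding lookup_const_mult \<mu>_J[OF \<beta>(1)] lookup_single_mult by simp
  moreover have "\<dots> \<noteq> 0" using c L(1)[OF \<gamma>s_NZ] by (simp add: in_keys_iff)
  ultimately have "\<beta> + L \<gamma>s \<in> keys (single 0 c * \<mu> (\<gamma>s + \<beta>))" by (simp only: in_keys_iff not_False_eq_True)
  then have "\<beta> + L \<gamma>s \<in> keys (\<Lambda> (single 0 1 * f'))" by (simp add: eq)
  then obtain \<delta> where \<delta>: "\<delta> \<in> keys f'" "\<beta> + L \<gamma>s \<in> keys (\<mu> (0 + \<delta>))" using key_transfer by blast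
  obtain \<gamma>' \<beta>' where split: "\<delta> = \<gamma>' + \<beta>'" "\<forall>j\<in>J. lookup \<gamma>' j = 0" "keys \<beta>' \<subseteq> J" by (rule split_off_J)
  obtain \<kappa> where \<kappa>: "\<beta> + L \<gamma>s = \<beta>' + \<kappa>" "\<kappa> \<in> keys (\<mu> \<gamma>')"
    using \<delta>(2) keys_single_mult[of \<beta>' 1 "\<mu> \<gamma>'"] by (auto simp: split(1) \<mu>_J[OF split(3)])
  have mons: "\<gamma>s \<in> mons n" "\<beta> \<in> mons n" "\<gamma>' \<in> mons n" "\<beta>' \<in> mons n" "\<kappa> \<in> mons n"
    using keys_f'[OF \<delta>(1)] split \<gamma>s_NZ mons_J \<beta>(1) keys_\<mu>_mons[OF \<kappa>(2)] by (auto simp: NZ_def)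
  have \<gamma>'_NZ: "\<gamma>' \<in> NZ" using mons split \<kappa>(2) by (auto simp: NZ_def)
  have Lmons: "L \<gamma>s \<in> mons n" "L \<gamma>' \<in> mons n" using L(2) \<gamma>s_NZ \<gamma>'_NZ by auto
  have 1: "leq lt (\<kappa> + (L \<gamma>' + \<gamma>s)) (L \<gamma>' + (L \<gamma>s + \<gamma>'))"
    by (rule leq_add_mono[OF ord L_max[OF \<kappa>(2)] max[OF \<gamma>'_NZ]]) (use mons Lmons in simp_all)
  have 2: "lt (\<gamma>' + \<beta>') (\<gamma>s + \<beta>)" using keys_f'[OF \<delta>(1)] split(1) by simp
  \<comment> \<open>Sum of three comparisons: \<kappa> against \<open>L \<gamma>'\<close>,
    maximality of \<open>\<gamma>s\<close>, and \<delta> below the leading exponent. Because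
    \<open>\<beta> + L \<gamma>s = \<beta>' + \<kappa>\<close>, both totals are the same
    exponent.\<close>
  have "lt ((\<kappa> + (L \<gamma>' + \<gamma>s)) + (\<gamma>' + \<beta>')) ((L \<gamma>' + (L \<gamma>s + \<gamma>')) + (\<gamma>s + \<beta>))"
    by (rule leq_lt_add_mono[OF ord 1 2]) (use mons Lmons in simp_all)
  moreover have "(\<kappa> + (L \<gamma>' + \<gamma>s)) + (\<gamma>' + \<beta>') = (\<beta>' + \<kappa>) + (L \<gamma>' + \<gamma>s + \<gamma>')"
    by (simp add: add_ac)
  moreover have "(L \<gamma>' + (L \<gamma>s + \<gamma>')) + (\<gamma>s + \<beta>) = (\<beta> + L \<gamma>s) + (L \<gamma>' + \<gamma>s + \<gamma>')"
    by (simp add: add_ac)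
  ultimately have "lt ((\<beta> + L \<gamma>s) + (L \<gamma>' + \<gamma>s + \<gamma>')) ((\<beta> + L \<gamma>s) + (L \<gamma>' + \<gamma>s + \<gamma>'))"
    by (simp only: \<kappa>(1))
  moreover have "(\<beta> + L \<gamma>s) + (L \<gamma>' + \<gamma>s + \<gamma>') \<in> mons n" using mons Lmons by simp
  ultimately show False using lt_irrefl[OF ord] by blast
qed

section \<open>Combination of the bound for each direction with the bound on the total\<close>

theorem mainTheorem2:
  fixes n d :: nat
    and lt :: "(nat \<Rightarrow>\<^sub>0 nat) \<Rightarrow> (nat \<Rightarrow>\<^sub>0 nat) \<Rightarrow> bool"
    and S :: "(nat \<Rightarrow> 'a::field) set set"
    and A :: "(nat \<Rightarrow> 'a) set"
  assumes "infinite (UNIV :: 'a set)"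
    and "n \<ge> 1" and "d \<le> n"
    and "term_order n lt" and "vars_increasing n lt"
    and "finite S" and "\<forall>P\<in>S. affine_plane n d P"
    and "A = \<Union> S"
  shows "\<forall>J. J \<subseteq> {..<n} \<and> card J = d \<longrightarrow>
           card (planes_in n (D_set n lt A) J) = card {P\<in>S. minimal_free_vars n d P J}"
proof (intro allI impI)
  fix J0 assume J0: "J0 \<subseteq> {..<n} \<and> card J0 = d"
  define ap where "ap J = apices n (D_set n lt A) J" for J
  define m where "m J = card {P\<in>S. minimal_free_vars n d P J}" for J
  define JJ where "JJ = {J. J \<subseteq> {..<n} \<and> card J = d}"
  have finJJ: "finite JJ" by (rule finite_subset[of _ "Pow {..<n}"]) (auto simp: JJ_def)
  have lower: "m J \<le> card (ap J)" if "finite (ap J)" "J \<in> JJ" for J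
    unfolding m_def ap_def
    by (rule card_apices_ge[OF assms(1,4,5)]) (use that assms in \<open>auto simp: JJ_def ap_def\<close>)
  \<comment> \<open>Each component is counted at least once, as it has some minimal free
    variables.\<close>
  have total: "card S \<le> (\<Sum>J\<in>JJ. m J)"
  proof -
    have "S \<subseteq> (\<Union>J\<in>JJ. {P\<in>S. minimal_free_vars n d P J})"
    proof
      fix P assume "P \<in> S"
      moreover from this obtain J where "minimal_free_vars n d P J"
        using affine_plane_has_minimal_free_vars assms(7) by blast
      ultimately show "P \<in> (\<Union>J\<in>JJ. {P\<in>S. minimal_free_vars n d P J})"
        by (auto simp: JJ_def minimal_free_vars_def free_vars_def)
    qed
    then have "card S \<le> card (\<Union>J\<in>JJ. {P\<in>S. minimal_free_vars n d P J})"
      using assms(6) finJJ by (intro card_mono) auto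
    also have "\<dots> \<le> (\<Sum>J\<in>JJ. m J)" unfolding m_def by (rule card_UN_le[OF finJJ])
    finally show ?thesis .
  qed
  have "finite (ap J0) \<and> card (ap J0) \<le> m J0"
  proof (rule ccontr)
    assume more: "\<not> ?thesis"
    \<comment> \<open>One plane more than expected at \<open>J0\<close>. Choosing
      \<open>m' J\<close> planes in every direction, also where there are infinitely many, gives a
      finite family larger than \<open>S\<close>, against the upper bound.\<close>
    define m' where "m' J = (if J = J0 then Suc (m J) else m J)" for J
    have "\<exists>F\<subseteq>ap J. finite F \<and> card F = m' J" if "J \<in> JJ" for J
    proof (cases "finite (ap J)")
      case True
      then have "m' J \<le> card (ap J)" using lower[OF True that] more by (auto simp: m'_def)
      then show ?thesis using obtain_subset_with_card_n[of "m' J" "ap J"] by metis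
    next
      case False
      then show ?thesis using infinite_arbitrarily_large[of "ap J" "m' J"] by blast
    qed
    then obtain F where F: "\<And>J. J \<in> JJ \<Longrightarrow> F J \<subseteq> ap J \<and> finite (F J) \<and> card (F J) = m' J" by metis
    have "card (SIGMA J:JJ. F J) \<le> card S"
      by (rule card_apices_le[OF assms(1,4,6,7)])
        (use F finJJ assms(8) in \<open>auto simp: JJ_def ap_def\<close>)
    also have "card (SIGMA J:JJ. F J) = (\<Sum>J\<in>JJ. m' J)" using F finJJ by (simp add: card_SigmaI)
    also have "\<dots> = Suc (\<Sum>J\<in>JJ. m J)"
    proof -
      have "J0 \<in> JJ" using J0 by (simp add: JJ_def)
      then show ?thesis using finJJ by (simp add: sum.remove[of JJ J0] m'_def)
    qed
    finally show False using total by simp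
  qed
  moreover have "card (planes_in n (D_set n lt A) J0) = card (ap J0)"
    unfolding planes_in_eq ap_def by (rule card_image[OF inj_on_cone])
  ultimately show "card (planes_in n (D_set n lt A) J0) = card {P\<in>S. minimal_free_vars n d P J0}"
    using lower[of J0] J0 by (auto simp: JJ_def m_def)
qed

end
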